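(* Let $\mathcal{C} = (c_n)_{n=1}^\infty$ be a sequence of complex numbers and $r$ a positive integer. Let $\Phi(z) = \sum_{n \geq 1} c_n z^n$ denote the ordinary generating function of $\mathcal{C}$. Let $\mathcal{C}' = (c'_n)_{n\geq 0}$ be the sequence with $c'_0 = r$ and $c'_n = c_{n}$ for $n\geq 1$. Then the following are equivalent. 1. The sequence $\mathcal{C}$ has unitary rank $r$. 2. The algorithm MRANK succeeds on the sequence $T[\mathcal{C}] = (c_{n+1})_{n \geq 0}$ and returns $r'$ and $\boldsymbol{\alpha} \in \mathbb{N}^{r'}$ so that $\boldsymbol{\alpha} \cdot \mathbf{1} = r$, where $\mathbf{1}$ is the all-ones vector of dimension $r'$. 3. For some $r' \leq r$, $\mathcal{C}$ satisfies an $r'$-th order simple linear recurrence and, with $\beta_1,\dots,\beta_{r'}$ the distinct nonzero roots of its characteristic polynomial, $c_n=\sum_{i=1}^{r'}\alpha_i\beta_i^n$ for all $n\ge 1$ with coefficients $\alpha_i \in\mathbb{N}$ for all $1\leq i\leq r'$ and $\sum_{i=1}^{r'}\alpha_i = r$. 4. If $H'_{r-1,t}$ is the $r \times r$ Hankel matrix whose first row consists of $c'_t,\ldots,c'_{t+r-1}$ (i.e. with $(i,j)$ entry $c'_{t+i+j-2}$), then there exists an $r\times r$ Vandermonde matrix $V = \mathrm{VDM}(\boldsymbol{\beta})$, $\boldsymbol{\beta}\in\mathbb{C}^r$, so that $H'_{r-1,t} = V^T D^t V$, where $D = \operatorname{diag}(\boldsymbol{\beta})$, for each $t\geq 0$.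 5. If $H_\infty'$ is the infinite Hankel matrix with entries from $\mathcal{C}'$ (i.e. with $(i,j)$ entry $c'_{i+j-2}$, $i,j\ge 1$), then there exists an $r\times\infty$ Vandermonde matrix $V'$ so that $H_\infty' = (V')^TV'$. 6. $\exp\left(\int -x^{-1} \Phi(x) \, dx\right)$ is a polynomial of degree $r$ with nonzero roots. 7. There exist a nonzero $r' \in \mathbb{N}$ and nonzero $\alpha_1,\ldots,\alpha_{r'}$, $\beta_1,\ldots,\beta_{r'}$, and $\lambda_1,\ldots,\lambda_{r'}$ in $\mathbb{C}$ so that, for each integer $t \geq 1$, $$\sum_{j=0}^{2r'} \binom{2r'}{j} c_{j+t}\, x^{2r'-j} y^{j} = \sum_{j=1}^{r'} \lambda_j (\beta_j/\alpha_j)^t (\alpha_j x + \beta_j y)^{2r'}$$ as polynomials in $x,y$, and the $\alpha_1,\dots,\alpha_{r'}$ are positive naturals that sum to $r$. 8. The sequence $\mathcal{C}$ is the moment sequence for a complex finite-atomic measure on $\mathbb{C}$ where the masses of the atoms are positive naturals with sum $r$ (that is, $c_n=\int_{\mathbb{C}} x^n\,d\mu$ for all $n\ge 1$ for such a measure $\mu$).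
   Context: Unitary rank: $\mathcal{C}=(c_n)_{n\ge 1}$ has unitary rank $r$ if $r$ is the smallest positive integer so that there exists a multiset of nonzero complex values $\{\beta_i\}_{i=1}^r$ with $c_n=\sum_{i=1}^r \beta_i^{n}$ for all $n\ge 1$. Simple recurrence: an $s$-th order linear recurrence $\sum_{j=0}^s a_j c_{j+t} = 0$ (with $a_j\in\mathbb{C}$), satisfied by the sequence for all $t$ for which all the terms are defined, is simple if its characteristic polynomial $\sum_{j=0}^s a_j x^j$ has distinct roots. Vandermonde matrices: $\mathrm{VDM}(\boldsymbol{\beta})$ for $\boldsymbol{\beta}=(\beta_1,\dots,\beta_r)$ is the $r\times r$ matrix with $(i,j)$ entry $\beta_i^{j-1}$; an $r\times\infty$ Vandermonde matrix has $(i,j)$ entry $a_i^{j-1}$, $1\le i\le r$, $j\ge 1$, for some $a_1,\dots,a_r\in\mathbb{C}$. In condition 6 the integral is an indefinite integral, $\int -x^{-1}\Phi(x)\,dx = -\sum_{n\ge 1} c_n x^n/n + C$ with $C$ a constant. Measures: a complex measure is a countably additive complex-valued function on a $\sigma$-algebra. A measure is finite-atomic if it is $k$-atomic for some finite $k$, i.e. there is a set $A$ with $|A|=k$ such that $\mu(\{x\})\neq 0$ for $x\in A$ and $\mu(B)=0$ for every measurable $B$ disjoint from $A$; the masses are the values $\mu(\{x\})$, $x\in A$. The $n$-th moment is $\int x^n\,d\mu$. Algorithm MRANK, on an input sequence $(d_n)_{n\ge 0}$ (here $d_n=c_{n+1}$): set $s=0$. Then: Step 1. $s\leftarrow s+1$.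 Step 2. Let $\mathbf{d}_t = (d_t,\ldots,d_{t+s-1})$ and let $\mathbf{D} = (\mathbf{d}_0^T, \ldots, \mathbf{d}_{s-1}^T)$ (an $s\times s$ matrix). Step 3. If $\det(\mathbf{D}) = 0$, go to Step 1; else continue. Step 4. Let $(a_0,\ldots,a_{s-1})^T = -\mathbf{D}^{-1} \mathbf{d}_s^T$ and define $p(x) = \sum_{n=0}^{s} a_n x^{n}$, where $a_s = 1$. Step 5. If $(d_n)_{n \geq 0}$ does not satisfy $\sum_{i=0}^{s} a_i d_{i+t} = 0$ for all $t \geq 0$, go to Step 1; else continue. Step 6. If $p$ has repeated roots, throw an error (not simple) and terminate; else continue. Step 7. Return $s$ and $\boldsymbol{\alpha} = (\mathbf{d}_0\, \mathrm{VDM}'(\boldsymbol{\beta})^{-1})^T$, where $\boldsymbol{\beta}=(\beta_1,\dots,\beta_s)$ is the vector of roots of $p$ and $\mathrm{VDM}'(\boldsymbol{\beta})$ is the $s\times s$ matrix with $(i,j)$ entry $\beta_i^{j}$. Each step is assumed to be carried out correctly in finite time. The algorithm succeeds if it reaches Step 7 and returns its output.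
   Formalization: Conditions 4, 5, 8 additionally require the β_i, the Vandermonde parameters a_i, and the atoms to be nonzero; condition 7 additionally requires λ_j α_j^{2r'} = α_j. Without these the converses to condition 1 fail (e.g. c_n=1, r=2; or c_n=1/2, r=1). *)

theory Defs
  imports
    "HOL-Analysis.Bochner_Integration"
    "HOL-Computational_Algebra.Formal_Power_Series"
    "HOL-Computational_Algebra.Polynomial_FPS"
    "Jordan_Normal_Form.Gauss_Jordan_Elimination"
    "Jordan_Normal_Form.Determinant"
begin

(* A sequence (c_n), n >= 1, is a function c on nat whose value c 0 is never used.
   Rows, columns and families 1..r are indexed by 0..<r. *)

section \<open>Unitary rank and recurrences\<close>

definition unitary_representation :: "(nat \<Rightarrow> complex) \<Rightarrow> complex multiset \<Rightarrow> bool" where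
  "unitary_representation c B \<longleftrightarrow> 0 \<notin># B \<and> (\<forall>n\<ge>1. c n = (\<Sum>\<beta>\<in>#B. \<beta> ^ n))"

definition has_unitary_rank :: "(nat \<Rightarrow> complex) \<Rightarrow> nat \<Rightarrow> bool" where
  "has_unitary_rank c r \<longleftrightarrow>
     r > 0 \<and> (\<exists>B. size B = r \<and> unitary_representation c B) \<and>
     (\<forall>s. 0 < s \<and> s < r \<longrightarrow> \<not> (\<exists>B. size B = s \<and> unitary_representation c B))"

(* The first argument is the index at which the sequence starts. *)
definition linear_recurrence ::
  "nat \<Rightarrow> (nat \<Rightarrow> complex) \<Rightarrow> nat \<Rightarrow> (nat \<Rightarrow> complex) \<Rightarrow> bool" where
  "linear_recurrence n0 c s a \<longleftrightarrow>
     a s \<noteq> 0 \<and> (\<forall>t\<ge>n0. (\<Sum>j\<le>s. a j * c (j + t)) = 0)"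

definition characteristic_poly :: "nat \<Rightarrow> (nat \<Rightarrow> complex) \<Rightarrow> complex poly" where
  "characteristic_poly s a = (\<Sum>j\<le>s. monom (a j) j)"

definition simple_recurrence ::
  "nat \<Rightarrow> (nat \<Rightarrow> complex) \<Rightarrow> nat \<Rightarrow> (nat \<Rightarrow> complex) \<Rightarrow> bool" where
  "simple_recurrence n0 c s a \<longleftrightarrow>
     linear_recurrence n0 c s a \<and> rsquarefree (characteristic_poly s a)"


section \<open>Hankel and Vandermonde matrices\<close>

(* The sequence c' of the theorem. *)
definition with_zeroth :: "nat \<Rightarrow> (nat \<Rightarrow> complex) \<Rightarrow> nat \<Rightarrow> complex" where
  "with_zeroth r c n = (if n = 0 then of_nat r else c n)"

definition hankel_mat :: "nat \<Rightarrow> (nat \<Rightarrow> complex) \<Rightarrow> nat \<Rightarrow> complex mat" where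
  "hankel_mat r e t = mat r r (\<lambda>(i, j). e (t + i + j))"

definition vdm :: "nat \<Rightarrow> (nat \<Rightarrow> complex) \<Rightarrow> complex mat" where
  "vdm r \<beta> = mat r r (\<lambda>(i, j). \<beta> i ^ j)"

definition vdm' :: "nat \<Rightarrow> (nat \<Rightarrow> complex) \<Rightarrow> complex mat" where
  "vdm' r \<beta> = mat r r (\<lambda>(i, j). \<beta> i ^ Suc j)"

definition hankel_inf :: "(nat \<Rightarrow> complex) \<Rightarrow> nat \<Rightarrow> nat \<Rightarrow> complex" where
  "hankel_inf e i j = e (i + j)"

definition vdm_inf :: "(nat \<Rightarrow> complex) \<Rightarrow> nat \<Rightarrow> nat \<Rightarrow> complex" where
  "vdm_inf a i j = a i ^ j"

(* The product of the transpose of V with V, for an r x infinity matrix V. *)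
definition gram_inf :: "nat \<Rightarrow> (nat \<Rightarrow> nat \<Rightarrow> complex) \<Rightarrow> nat \<Rightarrow> nat \<Rightarrow> complex" where
  "gram_inf r V i j = (\<Sum>k<r. V k i * V k j)"


section \<open>The algorithm MRANK\<close>

datatype mrank_outcome = Not_Simple | Return nat "complex Matrix.vec"

definition mrank_vec :: "(nat \<Rightarrow> complex) \<Rightarrow> nat \<Rightarrow> nat \<Rightarrow> complex Matrix.vec" where
  "mrank_vec d s t = Matrix.vec s (\<lambda>i. d (t + i))"

definition mrank_mat :: "(nat \<Rightarrow> complex) \<Rightarrow> nat \<Rightarrow> complex mat" where
  "mrank_mat d s = mat_of_cols s (map (mrank_vec d s) [0..<s])"

definition mrank_coeffs :: "(nat \<Rightarrow> complex) \<Rightarrow> nat \<Rightarrow> nat \<Rightarrow> complex" where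
  "mrank_coeffs d s n =
     (if n = s then 1
      else vec_index (- (the (mat_inverse (mrank_mat d s)) *\<^sub>v mrank_vec d s s)) n)"

(* mrank_run d s out: the run that enters Step 2 with counter value s ends with outcome out.
   A run that loops forever has no outcome, and neither has one that reaches Step 7 with a
   singular matrix VDM' (when 0 is a root of p), since the output is then undefined.
   The roots of p may be listed in any order, so the returned vector is determined only up to
   a permutation of its entries. *)
inductive mrank_run :: "(nat \<Rightarrow> complex) \<Rightarrow> nat \<Rightarrow> mrank_outcome \<Rightarrow> bool" for d where
  singular:
    "Determinant.det (mrank_mat d s) = 0 \<Longrightarrow> mrank_run d (Suc s) out \<Longrightarrow> mrank_run d s out"
| no_recurrence:
    "Determinant.det (mrank_mat d s) \<noteq> 0 \<Longrightarrow>
     \<not> linear_recurrence 0 d s (mrank_coeffs d s) \<Longrightarrow>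
     mrank_run d (Suc s) out \<Longrightarrow> mrank_run d s out"
| not_simple:
    "Determinant.det (mrank_mat d s) \<noteq> 0 \<Longrightarrow>
     linear_recurrence 0 d s (mrank_coeffs d s) \<Longrightarrow>
     \<not> rsquarefree (characteristic_poly s (mrank_coeffs d s)) \<Longrightarrow>
     mrank_run d s Not_Simple"
| return:
    "Determinant.det (mrank_mat d s) \<noteq> 0 \<Longrightarrow>
     linear_recurrence 0 d s (mrank_coeffs d s) \<Longrightarrow>
     rsquarefree (characteristic_poly s (mrank_coeffs d s)) \<Longrightarrow>
     bij_betw \<beta> {..<s} {z. poly (characteristic_poly s (mrank_coeffs d s)) z = 0} \<Longrightarrow>
     mat_inverse (vdm' s \<beta>) = Some W \<Longrightarrow>
     mrank_run d s (Return s (transpose_mat W *\<^sub>v mrank_vec d s 0))"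

definition MRANK :: "(nat \<Rightarrow> complex) \<Rightarrow> mrank_outcome \<Rightarrow> bool" where
  "MRANK d out \<longleftrightarrow> mrank_run d 1 out"


section \<open>Formal power series and bivariate polynomials\<close>

definition ogf :: "(nat \<Rightarrow> complex) \<Rightarrow> complex fps" where
  "ogf c = Abs_fps (\<lambda>n. if n = 0 then 0 else c n)"

(* Composition of formal power series is only meaningful for an inner series without constant
   term, so the constant term of F contributes the scalar factor exp (F_0). *)
definition fps_exponential :: "complex fps \<Rightarrow> complex fps" where
  "fps_exponential F =
     fps_const (exp (fps_nth F 0)) * fps_compose (fps_exp 1) (F - fps_const (fps_nth F 0))"

(* Polynomials in x, y over the complex numbers are elements of C[x][y]. *)
definition biv_const :: "complex \<Rightarrow> complex poly poly" where
  "biv_const a = [:[:a:]:]"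

definition biv_x :: "complex poly poly" where
  "biv_x = [:[:0, 1:]:]"

definition biv_y :: "complex poly poly" where
  "biv_y = [:0, 1:]"


section \<open>Complex measures\<close>

(* Only the space and the sigma-algebra of M matter in the following definitions. *)
definition complex_measure :: "'a measure \<Rightarrow> ('a set \<Rightarrow> complex) \<Rightarrow> bool" where
  "complex_measure M \<mu> \<longleftrightarrow>
     \<mu> {} = 0 \<and>
     (\<forall>A. range A \<subseteq> sets M \<longrightarrow> disjoint_family A \<longrightarrow>
        (\<lambda>i::nat. \<mu> (A i)) sums \<mu> (\<Union>i. A i))"

(* The positive part of a finite signed measure nu in its Jordan decomposition; ennreal maps
   negative numbers to 0. *)
definition positive_part :: "'a measure \<Rightarrow> ('a set \<Rightarrow> real) \<Rightarrow> 'a measure" where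
  "positive_part M \<nu> =
     measure_of (space M) (sets M) (\<lambda>E. SUP B\<in>{B \<in> sets M. B \<subseteq> E}. ennreal (\<nu> B))"

(* Integral with respect to a complex measure, via the Jordan decompositions of its real and
   imaginary parts. *)
definition has_complex_measure_integral ::
  "'a measure \<Rightarrow> ('a set \<Rightarrow> complex) \<Rightarrow> ('a \<Rightarrow> complex) \<Rightarrow> complex \<Rightarrow> bool" where
  "has_complex_measure_integral M \<mu> f I \<longleftrightarrow>
     (let P1 = positive_part M (\<lambda>E. Re (\<mu> E)); N1 = positive_part M (\<lambda>E. - Re (\<mu> E));
          P2 = positive_part M (\<lambda>E. Im (\<mu> E)); N2 = positive_part M (\<lambda>E. - Im (\<mu> E))
      in integrable P1 f \<and> integrable N1 f \<and> integrable P2 f \<and> integrable N2 f \<and>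
         I = (integral\<^sup>L P1 f - integral\<^sup>L N1 f)
             + \<i> * (integral\<^sup>L P2 f - integral\<^sup>L N2 f))"

definition finite_atomic :: "'a measure \<Rightarrow> ('a set \<Rightarrow> complex) \<Rightarrow> 'a set \<Rightarrow> bool" where
  "finite_atomic M \<mu> A \<longleftrightarrow>
     finite A \<and> (\<forall>x\<in>A. {x} \<in> sets M \<and> \<mu> {x} \<noteq> 0) \<and>
     (\<forall>B\<in>sets M. B \<inter> A = {} \<longrightarrow> \<mu> B = 0)"

end

theory Submission
  imports Defs "HOL-Computational_Algebra.Fundamental_Theorem_Algebra"
begin

text \<open>
  All conditions are read off from one normal form: \<open>c n\<close> is, for \<open>n \<ge> 1\<close>, a sum of \<open>n\<close>-th powers of
  \<open>r\<close> nonzero numbers, or equivalently a sum over distinct nonzero nodes with positive natural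
  weights. A weighted sum of powers of distinct nodes that vanishes for as many exponents as there
  are nodes has zero weights (test it against Lagrange polynomials). This makes the representation
  unique, so that minimality in the definition of unitary rank is automatic, and it forces
  the characteristic polynomial of every recurrence of the sequence to vanish at all nodes. Hence MRANK
  cannot stop before the counter reaches the number of nodes, and stops there. For the exponential, both it
  and the product of the factors \<open>1 - \<beta> x\<close> solve the same first-order differential equation. For the
  moments, a complex measure with finitely many atoms is a weighted sum of point masses, and for
  natural weights only the positive part of its real part is nonzero.
\<close>

section \<open>Power sums with distinct nodes\<close>

lemma sum_mset_count:
  fixes f :: "'a \<Rightarrow> 'b::comm_semiring_1"
  shows "(\<Sum>x\<in>#B. f x) = (\<Sum>x\<in>set_mset B. of_nat (count B x) * f x)"
proof (induction B)
  case (add x B)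
  have "(\<Sum>y\<in>set_mset (add_mset x B). of_nat (count (add_mset x B) y) * f y)
      = (\<Sum>y\<in>insert x (set_mset B). of_nat (count B y) * f y + (if y = x then f y else 0))"
    by (intro sum.cong) (auto simp: algebra_simps)
  also have "\<dots> = (\<Sum>y\<in>insert x (set_mset B). of_nat (count B y) * f y) + f x"
    by (simp add: sum.distrib sum.delta)
  also have "(\<Sum>y\<in>insert x (set_mset B). of_nat (count B y) * f y)
      = (\<Sum>y\<in>set_mset B. of_nat (count B y) * f y)"
    by (intro sum.mono_neutral_right) (auto simp: not_in_iff)
  finally show ?case using add.IH by (simp add: add.commute)
qed simp

text \<open>Linearity carries the vanishing from monomials to polynomials of low degree, which can
  then serve as test functions for the weights.\<close>

lemma weighted_sum_poly_eq_0:
  fixes w :: "'a::comm_ring_1 \<Rightarrow> 'a"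
  assumes "\<And>n. n < k \<Longrightarrow> (\<Sum>z\<in>S. w z * z ^ n) = 0" "degree p < k"
  shows "(\<Sum>z\<in>S. w z * poly p z) = 0"
proof -
  have "(\<Sum>z\<in>S. w z * poly p z) = (\<Sum>z\<in>S. \<Sum>i\<le>degree p. coeff p i * (w z * z ^ i))"
    by (simp add: poly_altdef sum_distrib_left mult_ac)
  also have "\<dots> = (\<Sum>i\<le>degree p. coeff p i * (\<Sum>z\<in>S. w z * z ^ i))"
    by (subst sum.swap) (simp add: sum_distrib_left)
  also have "\<dots> = 0"
    using assms by (intro sum.neutral) auto
  finally show ?thesis .
qed

text \<open>The Lagrange numerator at \<open>x\<close>, the product over the other nodes, has degree
  \<open>card S - 1\<close> and kills every term except that of \<open>x\<close>. This is
  invertibility of a Vandermonde matrix.\<close>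

lemma weights_eq_0:
  fixes w :: "'a::field \<Rightarrow> 'a"
  assumes "finite S" "\<And>n. n < card S \<Longrightarrow> (\<Sum>z\<in>S. w z * z ^ n) = 0" "x \<in> S"
  shows "w x = 0"
proof -
  define p where "p = (\<Prod>y\<in>S - {x}. [:- y, 1:])"
  have "degree p = card (S - {x})"
    by (simp add: p_def degree_prod_sum_eq)
  hence "degree p < card S"
    using assms(1,3) by (metis card_Diff1_less)
  hence "0 = (\<Sum>z\<in>S. w z * poly p z)"
    using weighted_sum_poly_eq_0[of "card S" w S p] assms(2) by simp
  also have "\<dots> = w x * poly p x"
    using assms(1,3) by (subst sum.remove[of _ x]) (auto intro!: sum.neutral simp: p_def poly_prod)
  finally show ?thesis
    using assms(1) by (auto simp: p_def poly_prod)
qed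

section \<open>Unitary representations\<close>

lemma unitary_representation_sum:
  assumes "unitary_representation c B" "n \<ge> 1"
  shows "c n = (\<Sum>z\<in>set_mset B. of_nat (count B z) * z ^ n)"
  using assms by (simp add: unitary_representation_def sum_mset_count)

text \<open>The difference of the multiplicities is a weight on the union of the supports whose
  power sums all vanish, so it is zero.\<close>

lemma unitary_representation_unique:
  assumes "unitary_representation c B" "unitary_representation c B'"
  shows "B = B'"
proof (rule multiset_eqI)
  fix x
  define S where "S = set_mset B \<union> set_mset B'"
  \<comment> \<open>The sequence starts at index 1. The factor \<open>z\<close> absorbs this shift
    of the exponents and can be cancelled later because 0 is not in \<open>S\<close>.\<close>
  define w :: "complex \<Rightarrow> complex" where "w z = (of_nat (count B z) - of_nat (count B' z)) * z" for z
  have S0: "0 \<notin> S"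
    using assms by (auto simp: S_def unitary_representation_def)
  have extend: "c n = (\<Sum>z\<in>S. of_nat (count A z) * z ^ n)"
    if "unitary_representation c A" "set_mset A \<subseteq> S" "n \<ge> 1" for A n
    using that unitary_representation_sum[of c A n]
    by (auto intro!: sum.mono_neutral_left simp: S_def not_in_iff)
  have "(\<Sum>z\<in>S. w z * z ^ n) = 0" for n
  proof -
    have "(\<Sum>z\<in>S. w z * z ^ n) = c (Suc n) - c (Suc n)"
      by (subst extend[OF assms(1)], simp add: S_def, simp, subst extend[OF assms(2)])
         (simp_all add: S_def w_def algebra_simps sum_subtractf)
    thus ?thesis by simp
  qed
  hence "w x = 0" if "x \<in> S"
    using weights_eq_0[of S w x] that by (simp add: S_def)
  thus "count B x = count B' x"
    using S0 by (cases "x \<in> S") (auto simp: w_def S_def not_in_iff)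
qed

text \<open>By uniqueness all representations have the same size, which makes the minimality clause
  automatic.\<close>

lemma has_unitary_rank_iff:
  assumes "r > 0"
  shows "has_unitary_rank c r \<longleftrightarrow> (\<exists>B. size B = r \<and> unitary_representation c B)"
  using assms unitary_representation_unique unfolding has_unitary_rank_def by blast

text \<open>The way back from every condition to the rank. Repeated nodes and zero weights are
  allowed, since the multiset merges the former and drops the latter.\<close>

lemma has_unitary_rankI:
  assumes "r > 0" "finite I" "\<And>i. i \<in> I \<Longrightarrow> \<beta> i \<noteq> 0" "(\<Sum>i\<in>I. \<alpha> i) = r"
    and "\<And>n. n \<ge> 1 \<Longrightarrow> c n = (\<Sum>i\<in>I. of_nat (\<alpha> i) * \<beta> i ^ n)"
  shows "has_unitary_rank c r"
proof -
  let ?B = "\<Sum>i\<in>I. replicate_mset (\<alpha> i) (\<beta> i)"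
  have size: "size ?B = (\<Sum>i\<in>I. \<alpha> i)"
    using assms(2) by (induction rule: finite_induct) auto
  have image: "(\<Sum>\<beta>\<in>#?B. \<beta> ^ n) = (\<Sum>i\<in>I. of_nat (\<alpha> i) * \<beta> i ^ n)" for n
    using assms(2) by (induction rule: finite_induct) auto
  have "0 \<notin># ?B"
    using assms(2,3) by (induction rule: finite_induct) (auto simp: in_replicate_mset)
  thus ?thesis
    using assms(1,4,5) size image unfolding has_unitary_rank_iff[OF assms(1)]
    by (auto simp: unitary_representation_def intro!: exI[of _ ?B])
qed

lemma has_unitary_rank_nodes:
  assumes "has_unitary_rank c r"
  obtains S and m :: "complex \<Rightarrow> nat" where "finite S" "S \<noteq> {}" "0 \<notin> S" "\<forall>z\<in>S. m z > 0" "sum m S = r"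
    "\<forall>n\<ge>1. c n = (\<Sum>z\<in>S. of_nat (m z) * z ^ n)"
proof -
  obtain B where B: "size B = r" "unitary_representation c B" and r: "r > 0"
    using assms by (auto simp: has_unitary_rank_def)
  show ?thesis
    using B r unitary_representation_sum[OF B(2)]
    by (intro that[of "set_mset B" "count B"])
       (auto simp: unitary_representation_def size_multiset_overloaded_eq)
qed

text \<open>Here \<open>k\<close> counts the distinct nodes, while \<open>r\<close> counts them with
  multiplicity. An index range replaces the set because recurrences and vectors are indexed.\<close>

lemma has_unitary_rank_enum:
  assumes "has_unitary_rank c r"
  obtains k and \<beta> :: "nat \<Rightarrow> complex" and \<alpha> :: "nat \<Rightarrow> nat" where "inj_on \<beta> {..<k}" "k > 0" "\<forall>i<k. \<beta> i \<noteq> 0"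
    "\<forall>i<k. \<alpha> i > 0" "(\<Sum>i<k. \<alpha> i) = r"
    "\<forall>n\<ge>1. c n = (\<Sum>i<k. of_nat (\<alpha> i) * \<beta> i ^ n)"
proof -
  obtain S m where S: "finite S" "S \<noteq> {}" "0 \<notin> S" "\<forall>z\<in>S. m z > 0" "sum m S = r"
    "\<forall>n\<ge>1. c n = (\<Sum>z\<in>S. of_nat (m z) * z ^ n)"
    using assms by (rule has_unitary_rank_nodes)
  obtain \<beta> where \<beta>: "bij_betw \<beta> {..<card S} S"
    using ex_bij_betw_nat_finite[OF S(1)] by (auto simp: atLeast0LessThan)
  have mem: "\<beta> i \<in> S" if "i < card S" for i
    using bij_betw_apply[OF \<beta>] that by auto
  show ?thesis
  proof (rule that[of \<beta> "card S" "m \<circ> \<beta>"])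
    show "(\<Sum>i<card S. (m \<circ> \<beta>) i) = r"
      using sum.reindex_bij_betw[OF \<beta>, of m] S(5) by simp
    show "\<forall>n\<ge>1. c n = (\<Sum>i<card S. of_nat ((m \<circ> \<beta>) i) * \<beta> i ^ n)"
      using sum.reindex_bij_betw[OF \<beta>, of "\<lambda>z. of_nat (m z) * z ^ _"] S(6) by simp
  qed (use \<beta> S mem in \<open>auto simp: bij_betw_def card_gt_0_iff\<close>)
qed

text \<open>Nodes are listed here with repetition, one for each unit of weight, as the Hankel
  matrices and the exponential require.\<close>

lemma has_unitary_rank_iff_power_sums:
  assumes "r > 0"
  shows "has_unitary_rank c r \<longleftrightarrow>
    (\<exists>\<beta>. (\<forall>i<r. \<beta> i \<noteq> 0) \<and> (\<forall>n\<ge>1. c n = (\<Sum>i<r. \<beta> i ^ n)))" (is "_ \<longleftrightarrow> ?R")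
proof
  assume "has_unitary_rank c r"
  then obtain B where B: "size B = r" "unitary_representation c B"
    using has_unitary_rank_iff[OF assms] by auto
  obtain xs where xs: "mset xs = B"
    using ex_mset by blast
  have len: "length xs = r"
    using B(1) xs by auto
  have "(\<Sum>z\<in>#B. z ^ n) = (\<Sum>i<r. (xs ! i) ^ n)" for n
    unfolding xs[symmetric] mset_map[symmetric] sum_mset_sum_list
    by (simp add: sum_list_sum_nth len atLeast0LessThan)
  moreover have "xs ! i \<noteq> 0" if "i < r" for i
  proof -
    have "xs ! i \<in># B"
      using that len xs by auto
    thus ?thesis
      using B(2) by (metis unitary_representation_def)
  qed
  ultimately show ?R
    using B(2) by (auto simp: unitary_representation_def intro!: exI[of _ "\<lambda>i. xs ! i"])
next
  assume ?R
  then obtain \<beta> where "\<forall>i<r. \<beta> i \<noteq> 0" "\<forall>n\<ge>1. c n = (\<Sum>i<r. \<beta> i ^ n)"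
    by auto
  thus "has_unitary_rank c r"
    using assms by (intro has_unitary_rankI[of r "{..<r}" \<beta> "\<lambda>_. 1"]) auto
qed


section \<open>Recurrences\<close>

lemma poly_characteristic_poly: "poly (characteristic_poly s a) z = (\<Sum>j\<le>s. a j * z ^ j)"
  by (simp add: characteristic_poly_def poly_sum poly_monom)

lemma coeff_characteristic_poly: "coeff (characteristic_poly s a) n = (if n \<le> s then a n else 0)"
  by (simp add: characteristic_poly_def coeff_sum)

lemma degree_characteristic_poly: "a s \<noteq> 0 \<Longrightarrow> degree (characteristic_poly s a) = s"
  by (intro antisym degree_le le_degree) (auto simp: coeff_characteristic_poly)

lemma characteristic_poly_coeff: "degree p = s \<Longrightarrow> characteristic_poly s (coeff p) = p"
  by (auto simp: poly_eq_iff coeff_characteristic_poly coeff_eq_0)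

text \<open>Writing the product as \<open>[:- x, 1:] * q\<close>, its derivative at \<open>x\<close>
  is the value of \<open>q\<close> there, and \<open>q\<close> has only the other roots.\<close>

lemma rsquarefree_prod_linear:
  fixes S :: "'a::field_char_0 set"
  assumes "finite S"
  shows "rsquarefree (\<Prod>z\<in>S. [:- z, 1:])"
  unfolding rsquarefree_roots
proof (intro allI notI, elim conjE)
  fix x assume x: "poly (\<Prod>z\<in>S. [:- z, 1:]) x = 0" "poly (pderiv (\<Prod>z\<in>S. [:- z, 1:])) x = 0"
  hence "x \<in> S"
    using assms by (auto simp: poly_prod)
  define q where "q = (\<Prod>z\<in>S - {x}. [:- z, 1:])"
  have "(\<Prod>z\<in>S. [:- z, 1:]) = [:- x, 1:] * q"
    unfolding q_def by (rule prod.remove[OF assms \<open>x \<in> S\<close>])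
  moreover have "poly (pderiv ([:- x, 1:] * q)) x = poly q x"
    unfolding pderiv_mult by (simp add: pderiv_pCons)
  ultimately have "poly q x = 0"
    using x(2) by metis
  thus False
    using assms by (auto simp: q_def poly_prod)
qed

text \<open>A recurrence acts on a geometric sequence by multiplication with the value of the
  characteristic polynomial at its ratio. The index \<open>t\<close> is fixed so that this also
  applies to \<open>c\<close>, whose representation starts at index 1.\<close>

lemma recurrence_sum_of_powers:
  assumes "\<And>j. j \<le> s \<Longrightarrow> e (j + t) = (\<Sum>i\<in>I. w i * \<beta> i ^ (j + t))"
  shows "(\<Sum>j\<le>s. a j * e (j + t)) = (\<Sum>i\<in>I. w i * poly (characteristic_poly s a) (\<beta> i) * \<beta> i ^ t)"
proof -
  have "(\<Sum>j\<le>s. a j * e (j + t)) = (\<Sum>j\<le>s. \<Sum>i\<in>I. a j * (w i * \<beta> i ^ (j + t)))"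
    using assms by (simp add: sum_distrib_left)
  also have "\<dots> = (\<Sum>i\<in>I. \<Sum>j\<le>s. a j * (w i * \<beta> i ^ (j + t)))"
    by (rule sum.swap)
  also have "\<dots> = (\<Sum>i\<in>I. w i * poly (characteristic_poly s a) (\<beta> i) * \<beta> i ^ t)"
    by (simp add: poly_characteristic_poly sum_distrib_left sum_distrib_right power_add mult_ac)
  finally show ?thesis .
qed

lemma has_unitary_rank_iff_simple_recurrence:
  assumes "r > 0"
  shows "has_unitary_rank c r \<longleftrightarrow>
        (\<exists>r'\<le>r. \<exists>a \<beta>. \<exists>\<alpha> :: nat \<Rightarrow> nat.
           simple_recurrence 1 c r' a \<and>
           bij_betw \<beta> {..<r'} {z. poly (characteristic_poly r' a) z = 0} \<and>
           (\<forall>i<r'. \<beta> i \<noteq> 0) \<and>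
           (\<forall>n\<ge>1. c n = (\<Sum>i<r'. of_nat (\<alpha> i) * \<beta> i ^ n)) \<and>
           (\<Sum>i<r'. \<alpha> i) = r)" (is "_ \<longleftrightarrow> ?R")
proof
  assume "has_unitary_rank c r"
  then obtain k and \<beta> :: "nat \<Rightarrow> complex" and \<alpha> :: "nat \<Rightarrow> nat" where
    *: "inj_on \<beta> {..<k}" and "k > 0" and **: "\<forall>i<k. \<beta> i \<noteq> 0"
    "\<forall>i<k. \<alpha> i > 0" "(\<Sum>i<k. \<alpha> i) = r"
    "\<forall>n\<ge>1. c n = (\<Sum>i<k. of_nat (\<alpha> i) * \<beta> i ^ n)"
    by (rule has_unitary_rank_enum)
  define p where "p = (\<Prod>z\<in>\<beta> ` {..<k}. [:- z, 1:])"
  have p_deg: "degree p = k"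
    using * by (simp add: p_def degree_prod_sum_eq card_image)
  have p_lead: "coeff p k = 1"
    using lead_coeff_prod[of "\<lambda>z. [:- z, 1:]" "\<beta> ` {..<k}"] p_deg by (simp add: p_def)
  have p_char: "characteristic_poly k (coeff p) = p"
    using p_deg by (rule characteristic_poly_coeff)
  have roots: "{z. poly p z = 0} = \<beta> ` {..<k}"
    by (auto simp: p_def poly_prod)
  have "k \<le> r"
    using sum_mono[of "{..<k}" "\<lambda>_. 1" \<alpha>] **(2,3) by (simp add: Suc_le_eq)
  moreover have "(\<Sum>j\<le>k. coeff p j * c (j + t)) = 0" if "t \<ge> 1" for t
    using roots recurrence_sum_of_powers[of k c t "\<lambda>i. of_nat (\<alpha> i)" \<beta> "{..<k}" "coeff p"] **(4) that
    by (auto simp: p_char intro!: sum.neutral)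
  hence "simple_recurrence 1 c k (coeff p)"
    using rsquarefree_prod_linear[of "\<beta> ` {..<k}"] p_lead p_char
    by (simp add: simple_recurrence_def linear_recurrence_def p_def)
  moreover have "bij_betw \<beta> {..<k} {z. poly (characteristic_poly k (coeff p)) z = 0}"
    using * roots p_char by (simp add: bij_betw_def)
  ultimately show ?R
    using **(1,3,4) by blast
next
  assume ?R
  thus "has_unitary_rank c r"
    using has_unitary_rankI[OF assms, of "{..<_}"] by blast
qed

section \<open>Hankel matrices\<close>

lemma mat_diag_pow:
  fixes f :: "nat \<Rightarrow> 'a::comm_semiring_1"
  shows "mat_diag n f ^\<^sub>m t = mat_diag n (\<lambda>i. f i ^ t)"
proof (induction t)
  case 0
  show ?case by (auto simp: mat_diag_def)
qed (simp add: mult.commute[of "f _"])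

text \<open>The two Vandermonde factors contribute the exponents \<open>i\<close> and
  \<open>j\<close>, the diagonal factor contributes \<open>t\<close>.\<close>

lemma vdm_gram_index:
  assumes "i < r" "j < r"
  shows "(transpose_mat (vdm r \<beta>) * (mat_diag r \<beta> ^\<^sub>m t) * vdm r \<beta>) $$ (i, j)
    = (\<Sum>k<r. \<beta> k ^ (t + i + j))"
proof -
  have "transpose_mat (vdm r \<beta>) \<in> carrier_mat r r"
    by (simp add: vdm_def)
  thus ?thesis
    using assms unfolding mat_diag_pow
    by (subst mat_diag_mult_right)
       (auto simp: vdm_def scalar_prod_def atLeast0LessThan power_add mult_ac intro!: sum.cong)
qed

text \<open>At index 0 both sides equal \<open>r\<close>, because each of the \<open>r\<close>
  powers with exponent 0 is 1.\<close>

lemma has_unitary_rank_iff_zeroth: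
  assumes "r > 0"
  shows "has_unitary_rank c r \<longleftrightarrow>
    (\<exists>\<beta>. (\<forall>i<r. \<beta> i \<noteq> 0) \<and> (\<forall>n. with_zeroth r c n = (\<Sum>i<r. \<beta> i ^ n)))"
proof -
  have "(\<forall>n. with_zeroth r c n = (\<Sum>i<r. \<beta> i ^ n)) \<longleftrightarrow> (\<forall>n\<ge>1. c n = (\<Sum>i<r. \<beta> i ^ n))" for \<beta>
    by (auto simp: with_zeroth_def)
  thus ?thesis
    by (simp add: has_unitary_rank_iff_power_sums[OF assms])
qed

text \<open>An entry depends only on \<open>t + i + j\<close>, so the corner entries for all
  \<open>t\<close> already contain every power sum; a corner exists because
  \<open>r > 0\<close>.\<close>

lemma has_unitary_rank_iff_hankel:
  assumes "r > 0"
  shows "has_unitary_rank c r \<longleftrightarrow>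
        (\<exists>\<beta> :: nat \<Rightarrow> complex. (\<forall>i<r. \<beta> i \<noteq> 0) \<and>
           (\<forall>t. hankel_mat r (with_zeroth r c) t =
                transpose_mat (vdm r \<beta>) * (mat_diag r \<beta> ^\<^sub>m t) * vdm r \<beta>))"
proof -
  have "(\<forall>t. hankel_mat r (with_zeroth r c) t =
             transpose_mat (vdm r \<beta>) * (mat_diag r \<beta> ^\<^sub>m t) * vdm r \<beta>) \<longleftrightarrow>
        (\<forall>n. with_zeroth r c n = (\<Sum>i<r. \<beta> i ^ n))" (is "?L \<longleftrightarrow> ?R") for \<beta>
  proof
    assume L: ?L
    show ?R
    proof
      fix n
      have "hankel_mat r (with_zeroth r c) n $$ (0, 0) = (\<Sum>i<r. \<beta> i ^ n)"
        using L vdm_gram_index[of 0 r 0 \<beta> n] assms by simp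
      thus "with_zeroth r c n = (\<Sum>i<r. \<beta> i ^ n)"
        using assms by (simp add: hankel_mat_def)
    qed
  next
    assume R: ?R
    show ?L
    proof (intro allI eq_matI)
      fix t i j
      assume "i < dim_row (transpose_mat (vdm r \<beta>) * (mat_diag r \<beta> ^\<^sub>m t) * vdm r \<beta>)"
        and "j < dim_col (transpose_mat (vdm r \<beta>) * (mat_diag r \<beta> ^\<^sub>m t) * vdm r \<beta>)"
      hence "i < r" "j < r"
        by (auto simp: vdm_def)
      thus "hankel_mat r (with_zeroth r c) t $$ (i, j) =
          (transpose_mat (vdm r \<beta>) * (mat_diag r \<beta> ^\<^sub>m t) * vdm r \<beta>) $$ (i, j)"
        using R by (simp add: vdm_gram_index hankel_mat_def)
    qed (auto simp: hankel_mat_def vdm_def)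
  qed
  thus ?thesis
    by (simp add: has_unitary_rank_iff_zeroth[OF assms])
qed

text \<open>Row 0 contains every power sum, and the other rows repeat them with a shift.\<close>

lemma has_unitary_rank_iff_hankel_inf:
  assumes "r > 0"
  shows "has_unitary_rank c r \<longleftrightarrow>
        (\<exists>a :: nat \<Rightarrow> complex. (\<forall>i<r. a i \<noteq> 0) \<and>
           hankel_inf (with_zeroth r c) = gram_inf r (vdm_inf a))"
proof -
  have "hankel_inf (with_zeroth r c) = gram_inf r (vdm_inf a) \<longleftrightarrow>
        (\<forall>n. with_zeroth r c n = (\<Sum>i<r. a i ^ n))" for a
    by (auto simp: fun_eq_iff hankel_inf_def gram_inf_def vdm_inf_def simp flip: power_add)
       (metis add_0)
  thus ?thesis
    by (simp add: has_unitary_rank_iff_zeroth[OF assms])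
qed

section \<open>Binomial sums\<close>

lemma eval_biv:
  "poly (poly (biv_const a) y) x = a" "poly (poly biv_x y) x = x" "poly (poly biv_y [:y':]) x = y'"
  by (simp_all add: biv_const_def biv_x_def biv_y_def)

lemma biv_const_hom:
  "biv_const (a + b) = biv_const a + biv_const b" "biv_const (a * b) = biv_const a * biv_const b"
  "biv_const 0 = 0" "biv_const 1 = 1"
  by (simp_all add: biv_const_def one_pCons)

lemma biv_const_power: "biv_const (a ^ n) = biv_const a ^ n"
  by (induction n) (simp_all add: biv_const_hom)

lemma biv_const_of_nat: "biv_const (of_nat n) = of_nat n"
  by (induction n) (simp_all add: biv_const_hom)

lemma biv_const_sum: "biv_const (\<Sum>i\<in>I. f i) = (\<Sum>i\<in>I. biv_const (f i))"
  by (induction I rule: infinite_finite_induct) (simp_all add: biv_const_hom)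

lemma biv_linear_form_power:
  "(biv_const a * biv_x + biv_const b * biv_y) ^ N =
   (\<Sum>j\<le>N. biv_const (of_nat (N choose j) * a ^ (N - j) * b ^ j) * biv_x ^ (N - j) * biv_y ^ j)"
proof -
  \<comment> \<open>In the swapped order \<open>binomial_ring\<close> gives the exponent
    \<open>j\<close> to the \<open>biv_y\<close> term.\<close>
  have "(biv_const a * biv_x + biv_const b * biv_y) ^ N = (biv_const b * biv_y + biv_const a * biv_x) ^ N"
    by (simp add: add.commute)
  also have "\<dots> = (\<Sum>j\<le>N. biv_const (of_nat (N choose j) * a ^ (N - j) * b ^ j) * biv_x ^ (N - j) * biv_y ^ j)"
    unfolding binomial_ring
    by (simp add: power_mult_distrib biv_const_hom biv_const_power biv_const_of_nat mult_ac)
  finally show ?thesis .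
qed

text \<open>The coefficient of \<open>biv_x ^ (2 * r' - j) * biv_y ^ j\<close> on the right, without
  its binomial factor, is the sum over \<open>i\<close> of \<open>lam i * \<alpha> i ^ (2 * r') *
  (\<beta> i / \<alpha> i) ^ (j + t)\<close>. So the ratios are the nodes, and the normalisation
  makes the \<open>\<alpha> i\<close> their weights.\<close>

lemma has_unitary_rank_iff_binomial_sums:
  assumes "r > 0"
  shows "has_unitary_rank c r \<longleftrightarrow>
        (\<exists>r'>0. \<exists>\<alpha> \<beta> lam :: nat \<Rightarrow> complex.
           (\<forall>j<r'. \<alpha> j \<noteq> 0 \<and> \<beta> j \<noteq> 0 \<and> lam j \<noteq> 0) \<and>
           (\<forall>t\<ge>1.
              (\<Sum>j\<le>2 * r'. biv_const (of_nat (2 * r' choose j) * c (j + t))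
                              * biv_x ^ (2 * r' - j) * biv_y ^ j) =
              (\<Sum>j<r'. biv_const (lam j * (\<beta> j / \<alpha> j) ^ t)
                          * (biv_const (\<alpha> j) * biv_x + biv_const (\<beta> j) * biv_y) ^ (2 * r'))) \<and>
           (\<forall>j<r'. \<alpha> j \<in> \<nat>) \<and> (\<Sum>j<r'. \<alpha> j) = of_nat r \<and>
           (\<forall>j<r'. lam j * \<alpha> j ^ (2 * r') = \<alpha> j))" (is "_ \<longleftrightarrow> ?R")
proof
  assume "has_unitary_rank c r"
  then obtain k and \<gamma> :: "nat \<Rightarrow> complex" and m :: "nat \<Rightarrow> nat" where
    "inj_on \<gamma> {..<k}" and *: "k > 0" "\<forall>i<k. \<gamma> i \<noteq> 0"
    "\<forall>i<k. m i > 0" "(\<Sum>i<k. m i) = r"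
    "\<forall>n\<ge>1. c n = (\<Sum>i<k. of_nat (m i) * \<gamma> i ^ n)"
    by (rule has_unitary_rank_enum)
  \<comment> \<open>The multiplicities must appear as \<open>\<alpha>\<close>. Then
    \<open>\<beta>\<close> is forced by the ratio \<open>\<gamma> i\<close>, and \<open>lam\<close>
    by the normalisation.\<close>
  define \<alpha> :: "nat \<Rightarrow> complex" where "\<alpha> i = of_nat (m i)" for i
  define \<beta> where "\<beta> i = \<alpha> i * \<gamma> i" for i
  define lam where "lam i = \<alpha> i / \<alpha> i ^ (2 * k)" for i
  have nz: "\<alpha> i \<noteq> 0" if "i < k" for i
    using *(3) that by (simp add: \<alpha>_def)
  have "(\<Sum>j\<le>2 * k. biv_const (of_nat (2 * k choose j) * c (j + t)) * biv_x ^ (2 * k - j) * biv_y ^ j) =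
        (\<Sum>i<k. biv_const (lam i * (\<beta> i / \<alpha> i) ^ t)
                          * (biv_const (\<alpha> i) * biv_x + biv_const (\<beta> i) * biv_y) ^ (2 * k))"
    (is "?l = ?r") if "t \<ge> 1" for t
  proof -
    have term_eq: "lam i * (\<beta> i / \<alpha> i) ^ t * (of_nat (2 * k choose j) * \<alpha> i ^ (2 * k - j) * \<beta> i ^ j)
        = of_nat (2 * k choose j) * (of_nat (m i) * \<gamma> i ^ (j + t))" if "i < k" "j \<le> 2 * k" for i j
    proof -
      have "\<alpha> i ^ (2 * k) = \<alpha> i ^ (2 * k - j) * \<alpha> i ^ j"
        using that by (simp flip: power_add)
      thus ?thesis
        using nz[OF that(1)]
        by (simp add: lam_def \<beta>_def power_mult_distrib power_add) (simp add: \<alpha>_def)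
    qed
    have "?r = (\<Sum>i<k. \<Sum>j\<le>2 * k. biv_const (lam i * (\<beta> i / \<alpha> i) ^ t *
        (of_nat (2 * k choose j) * \<alpha> i ^ (2 * k - j) * \<beta> i ^ j)) * biv_x ^ (2 * k - j) * biv_y ^ j)"
      unfolding biv_linear_form_power sum_distrib_left by (simp add: biv_const_hom mult.assoc)
    also have "\<dots> = (\<Sum>j\<le>2 * k. \<Sum>i<k. biv_const (of_nat (2 * k choose j) * (of_nat (m i) * \<gamma> i ^ (j + t)))
        * biv_x ^ (2 * k - j) * biv_y ^ j)"
      by (subst sum.swap) (auto intro!: sum.cong simp: term_eq)
    also have "\<dots> = ?l"
      using *(5) that by (simp add: sum_distrib_left biv_const_sum flip: sum_distrib_right)
    finally show ?thesis ..
  qed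
  moreover have "(\<Sum>j<k. \<alpha> j) = of_nat r"
    using *(4) by (simp add: \<alpha>_def flip: of_nat_sum)
  moreover have "\<alpha> j \<noteq> 0 \<and> \<beta> j \<noteq> 0 \<and> lam j \<noteq> 0" "\<alpha> j \<in> \<nat>"
    "lam j * \<alpha> j ^ (2 * k) = \<alpha> j" if "j < k" for j
    using nz[OF that] *(2) that by (simp_all add: \<beta>_def lam_def) (simp add: \<alpha>_def)
  ultimately show ?R
    using *(1) by blast
next
  assume ?R
  then obtain k \<alpha> \<beta> lam where *: "\<forall>j<k. \<alpha> j \<noteq> 0 \<and> \<beta> j \<noteq> 0 \<and> lam j \<noteq> 0"
    and eq: "\<forall>t\<ge>1. (\<Sum>j\<le>2 * k. biv_const (of_nat (2 * k choose j) * c (j + t))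
                              * biv_x ^ (2 * k - j) * biv_y ^ j) =
              (\<Sum>j<k. biv_const (lam j * (\<beta> j / \<alpha> j) ^ t)
                          * (biv_const (\<alpha> j) * biv_x + biv_const (\<beta> j) * biv_y) ^ (2 * k))"
    and \<alpha>: "\<forall>j<k. \<alpha> j \<in> \<nat>" "(\<Sum>j<k. \<alpha> j) = of_nat r" "\<forall>j<k. lam j * \<alpha> j ^ (2 * k) = \<alpha> j"
    by blast
  have "\<forall>j<k. \<exists>m. \<alpha> j = of_nat m"
    using \<alpha>(1) by (auto elim: Nats_cases)
  then obtain m where m: "\<And>j. j < k \<Longrightarrow> \<alpha> j = of_nat (m j)"
    by metis
  show "has_unitary_rank c r"
  proof (rule has_unitary_rankI[OF assms, of "{..<k}" "\<lambda>j. \<beta> j / \<alpha> j" m])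
    have "(of_nat (\<Sum>j<k. m j) :: complex) = of_nat r"
      using \<alpha>(2) m by simp
    thus "(\<Sum>j<k. m j) = r"
      unfolding of_nat_eq_iff .
    fix t :: nat assume "t \<ge> 1"
    \<comment> \<open>Evaluating at x = 1 and y = 0 leaves only the term j = 0.\<close>
    from arg_cong[OF eq[rule_format, OF \<open>t \<ge> 1\<close>], of "\<lambda>P. poly (poly P [:0:]) 1"]
    have "(\<Sum>j\<le>2 * k. of_nat (2 * k choose j) * c (j + t) * 0 ^ j)
        = (\<Sum>j<k. lam j * (\<beta> j / \<alpha> j) ^ t * \<alpha> j ^ (2 * k))"
      by (simp only: poly_sum poly_mult poly_power poly_add eval_biv power_one mult_1_right mult_zero_right add_0_right)
    moreover have "(\<Sum>j\<le>2 * k. of_nat (2 * k choose j) * c (j + t) * 0 ^ j) = c t"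
      by (subst sum.remove[of _ 0]) (auto intro!: sum.neutral)
    moreover have "(\<Sum>j<k. lam j * (\<beta> j / \<alpha> j) ^ t * \<alpha> j ^ (2 * k))
        = (\<Sum>j<k. of_nat (m j) * (\<beta> j / \<alpha> j) ^ t)"
      using \<alpha>(3) m by (intro sum.cong) (auto simp: mult_ac)
    ultimately show "c t = (\<Sum>j<k. of_nat (m j) * (\<beta> j / \<alpha> j) ^ t)"
      by simp
  qed (use * in auto)
qed

section \<open>The algorithm MRANK\<close>

lemma mrank_mat_carrier [simp]: "mrank_mat d s \<in> carrier_mat s s"
  by (auto simp: mrank_mat_def mrank_vec_def intro: mat_of_cols_carrier)

lemma mrank_mat_dim [simp]: "dim_row (mrank_mat d s) = s" "dim_col (mrank_mat d s) = s"
  using mrank_mat_carrier[of d s] by blast+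

lemma mrank_mat_index: "i < s \<Longrightarrow> j < s \<Longrightarrow> mrank_mat d s $$ (i, j) = d (i + j)"
  by (simp add: mrank_mat_def mat_of_cols_index mrank_vec_def add.commute)

lemma mrank_mat_mult_index:
  assumes "v \<in> carrier_vec s" "i < s"
  shows "vec_index (mrank_mat d s *\<^sub>v v) i = (\<Sum>j<s. d (i + j) * vec_index v j)"
  using assms by (auto simp: scalar_prod_def mrank_mat_index atLeast0LessThan intro!: sum.cong)

lemma vdm'_carrier [simp]: "vdm' s \<beta> \<in> carrier_mat s s"
  by (simp add: vdm'_def)

lemma vdm'_dim [simp]: "dim_row (vdm' s \<beta>) = s" "dim_col (vdm' s \<beta>) = s"
  by (simp_all add: vdm'_def)

lemma mat_inverse_of_det_nonzero:
  fixes A :: "'a::field mat"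
  assumes "A \<in> carrier_mat n n" "Determinant.det A \<noteq> 0"
  obtains B where "mat_inverse A = Some B" "A * B = 1\<^sub>m n" "B * A = 1\<^sub>m n" "B \<in> carrier_mat n n"
proof (cases "mat_inverse A")
  case None
  thus ?thesis
    using mat_inverse(1)[OF assms(1), where b = "()"] det_non_zero_imp_unit[OF assms, where b = "()"] by blast
next
  case (Some B)
  thus ?thesis
    using mat_inverse(2)[OF assms(1) Some] that by blast
qed

text \<open>The first \<open>s\<close> instances of a monic recurrence form a linear system for its
  lower coefficients, whose matrix is the one of the algorithm. As this matrix is nonsingular, the
  computed coefficients must be those of \<open>a\<close>.\<close>

lemma mrank_coeffs_eqI:
  assumes "Determinant.det (mrank_mat d s) \<noteq> 0" "a s = 1" "j \<le> s"
    and "\<And>t. t < s \<Longrightarrow> (\<Sum>j\<le>s. a j * d (j + t)) = 0"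
  shows "mrank_coeffs d s j = a j"
proof (cases "j = s")
  case False
  obtain B where B: "mat_inverse (mrank_mat d s) = Some B" "B * mrank_mat d s = 1\<^sub>m s"
    "B \<in> carrier_mat s s"
    using mat_inverse_of_det_nonzero[OF mrank_mat_carrier assms(1)] by metis
  let ?v = "Matrix.vec s a"
  have D: "mrank_mat d s *\<^sub>v ?v = - mrank_vec d s s"
  proof (rule eq_vecI)
    fix t assume "t < dim_vec (- mrank_vec d s s)"
    hence t: "t < s"
      by (simp add: mrank_vec_def)
    have "0 = (\<Sum>j<s. a j * d (j + t)) + d (s + t)"
      using assms(4)[OF t] assms(2) by (simp add: lessThan_Suc_atMost[symmetric])
    thus "vec_index (mrank_mat d s *\<^sub>v ?v) t = vec_index (- mrank_vec d s s) t"
      using t by (simp add: mrank_mat_mult_index mrank_vec_def mult.commute add.commute eq_neg_iff_add_eq_0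
          del: index_mult_mat_vec)
  qed (simp add: mrank_vec_def)
  have "B *\<^sub>v mrank_vec d s s = - (B *\<^sub>v (mrank_mat d s *\<^sub>v ?v))"
    unfolding D using B(3) by (intro eq_vecI) (auto simp: mrank_vec_def)
  also have "B *\<^sub>v (mrank_mat d s *\<^sub>v ?v) = ?v"
    using B(2,3) assoc_mult_mat_vec[of B s s "mrank_mat d s" s ?v] by simp
  finally have "- (B *\<^sub>v mrank_vec d s s) = ?v"
    by simp
  thus ?thesis
    using False assms(3) B(1) by (simp add: mrank_coeffs_def)
qed (use assms(2) in \<open>simp add: mrank_coeffs_def\<close>)

text \<open>The vector is read as the coefficients of a polynomial of degree below \<open>s\<close>;
  with \<open>s\<close> roots it must be zero. Both determinant lemmas below apply this to a kernel
  vector.\<close>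

lemma poly_of_vec_roots_imp_zero:
  fixes v :: "complex Matrix.vec"
  assumes "v \<in> carrier_vec s" "finite S" "card S = s"
    and "\<And>z. z \<in> S \<Longrightarrow> (\<Sum>j<s. vec_index v j * z ^ j) = 0"
  shows "v = 0\<^sub>v s"
proof (rule ccontr)
  assume "v \<noteq> 0\<^sub>v s"
  moreover have "v = 0\<^sub>v s" if "\<forall>i<s. vec_index v i = 0"
    using that assms(1) by (intro eq_vecI) auto
  ultimately obtain i where i: "i < s" "vec_index v i \<noteq> 0"
    by blast
  define q where "q = (\<Sum>j<s. monom (vec_index v j) j)"
  have coeff: "coeff q n = (if n < s then vec_index v n else 0)" for n
    by (simp add: q_def coeff_sum)
  have "q \<noteq> 0"
    using coeff[of i] i by auto
  have "poly q z = 0" if "z \<in> S" for z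
    using assms(4)[OF that] by (simp add: q_def poly_sum poly_monom)
  hence "s \<le> card {z. poly q z = 0}"
    using assms(3) poly_roots_finite[OF \<open>q \<noteq> 0\<close>] by (auto intro!: card_mono)
  also have "\<dots> \<le> degree q"
    by (rule card_poly_roots_bound[OF \<open>q \<noteq> 0\<close>])
  \<comment> \<open>\<open>i < s\<close> makes \<open>s\<close> positive, so the truncated
    \<open>s - 1\<close> is strictly below \<open>s\<close>.\<close>
  also have "degree q < s"
    using i coeff by (intro le_less_trans[OF degree_le[of "s - 1"]]) auto
  finally show False by simp
qed

text \<open>Row \<open>i\<close> is \<open>\<beta> i\<close> times a Vandermonde row, so after
  cancelling the nonzero factor a kernel vector is a polynomial vanishing at \<open>s\<close>
  nodes.\<close>

lemma det_vdm'_nonzero: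
  assumes "inj_on \<beta> {..<s}" "\<And>i. i < s \<Longrightarrow> \<beta> i \<noteq> 0"
  shows "Determinant.det (vdm' s \<beta>) \<noteq> 0"
proof
  assume "Determinant.det (vdm' s \<beta>) = 0"
  then obtain v where v: "v \<in> carrier_vec s" "v \<noteq> 0\<^sub>v s" "vdm' s \<beta> *\<^sub>v v = 0\<^sub>v s"
    using det_0_iff_vec_prod_zero[OF vdm'_carrier] by blast
  have "(\<Sum>j<s. vec_index v j * \<beta> i ^ j) = 0" if "i < s" for i
  proof -
    have "0 = vec_index (vdm' s \<beta> *\<^sub>v v) i"
      using v(3) that by simp
    also have "\<dots> = \<beta> i * (\<Sum>j<s. vec_index v j * \<beta> i ^ j)"
      using that v(1)
      by (auto simp: vdm'_def scalar_prod_def sum_distrib_left atLeast0LessThan mult_ac intro!: sum.cong)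
    finally show ?thesis
      using assms(2)[OF that] by simp
  qed
  hence "v = 0\<^sub>v s"
    using assms(1) v(1) by (intro poly_of_vec_roots_imp_zero[where S = "\<beta> ` {..<s}"]) (auto simp: card_image)
  with v(2) show False ..
qed

text \<open>Applied to the coefficient vector of \<open>q\<close>, the matrix yields the power sums
  with weights \<open>w z * q z\<close> for exponents below \<open>s\<close>. If these vanish, so do
  the weights, and \<open>q\<close> is zero at all \<open>s\<close> nodes.\<close>

lemma det_mrank_mat_nonzero:
  assumes "finite S" "card S = s" "\<And>z. z \<in> S \<Longrightarrow> w z \<noteq> 0" "\<And>n. d n = (\<Sum>z\<in>S. w z * z ^ n)"
  shows "Determinant.det (mrank_mat d s) \<noteq> 0"
proof
  assume "Determinant.det (mrank_mat d s) = 0"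
  then obtain v where v: "v \<in> carrier_vec s" "v \<noteq> 0\<^sub>v s" "mrank_mat d s *\<^sub>v v = 0\<^sub>v s"
    using det_0_iff_vec_prod_zero[OF mrank_mat_carrier] by blast
  define q where "q z = (\<Sum>j<s. vec_index v j * z ^ j)" for z
  have "(\<Sum>z\<in>S. w z * q z * z ^ i) = 0" if "i < s" for i
  proof -
    have "0 = vec_index (mrank_mat d s *\<^sub>v v) i"
      using v(3) that by simp
    also have "\<dots> = (\<Sum>j<s. \<Sum>z\<in>S. vec_index v j * (w z * z ^ (i + j)))"
      using v(1) that by (simp add: mrank_mat_mult_index assms(4) sum_distrib_left sum_distrib_right mult_ac
          del: index_mult_mat_vec)
    also have "\<dots> = (\<Sum>z\<in>S. w z * q z * z ^ i)"
      by (subst sum.swap) (simp add: q_def sum_distrib_left sum_distrib_right power_add mult_ac)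
    finally show ?thesis by simp
  qed
  hence "w z * q z = 0" if "z \<in> S" for z
    using weights_eq_0[of S "\<lambda>z. w z * q z" z] assms(1,2) that by simp
  hence "q z = 0" if "z \<in> S" for z
    using assms(3) that by auto
  hence "v = 0\<^sub>v s"
    using assms(1,2) v(1) by (intro poly_of_vec_roots_imp_zero[of v s S]) (auto simp: q_def)
  with v(2) show False ..
qed

text \<open>The recurrence multiplies each weight by a value of the characteristic polynomial; the
  new power sums vanish, hence so do the new weights.\<close>

lemma linear_recurrence_roots:
  assumes "finite S" "\<And>z. z \<in> S \<Longrightarrow> w z \<noteq> 0" "\<And>n. d n = (\<Sum>z\<in>S. w z * z ^ n)"
    and "linear_recurrence 0 d s a" "z \<in> S"
  shows "poly (characteristic_poly s a) z = 0"
proof -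
  have "(\<Sum>x\<in>S. w x * poly (characteristic_poly s a) x * x ^ t) = 0" for t
    using assms(4) recurrence_sum_of_powers[of s d t w "\<lambda>z. z" S a] assms(3)
    by (simp add: linear_recurrence_def)
  hence "w z * poly (characteristic_poly s a) z = 0"
    using weights_eq_0[OF assms(1), of "\<lambda>x. w x * poly (characteristic_poly s a) x" z] assms(5) by simp
  thus ?thesis
    using assms(2)[OF assms(5)] by simp
qed

text \<open>All nodes are roots of the characteristic polynomial, which has degree \<open>s\<close>
  because \<open>a s \<noteq> 0\<close>, and so at most \<open>s\<close> roots.\<close>

lemma no_short_linear_recurrence:
  assumes "finite S" "\<And>z. z \<in> S \<Longrightarrow> w z \<noteq> 0" "\<And>n. d n = (\<Sum>z\<in>S. w z * z ^ n)" "s < card S"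
  shows "\<not> linear_recurrence 0 d s a"
proof
  assume rec: "linear_recurrence 0 d s a"
  hence "a s \<noteq> 0"
    by (simp add: linear_recurrence_def)
  hence deg: "degree (characteristic_poly s a) = s" and nz: "characteristic_poly s a \<noteq> 0"
    by (auto simp: degree_characteristic_poly coeff_characteristic_poly dest: arg_cong[of _ _ "\<lambda>p. coeff p s"])
  have "card S \<le> card {z. poly (characteristic_poly s a) z = 0}"
    using linear_recurrence_roots[OF assms(1-3) rec] poly_roots_finite[OF nz] by (intro card_mono) auto
  also have "\<dots> \<le> s"
    using card_poly_roots_bound[OF nz] deg by simp
  finally show False
    using assms(4) by simp
qed

text \<open>Where no recurrence of order \<open>i\<close> exists, the run moves on whether or not
  the determinant vanishes, so an outcome can be pulled back to earlier counters.\<close>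

lemma mrank_run_skip:
  assumes "k \<le> s" "\<And>a i. k \<le> i \<Longrightarrow> i < s \<Longrightarrow> \<not> linear_recurrence 0 d i a" "mrank_run d s out"
  shows "mrank_run d k out"
  using assms(1)
proof (induction rule: inc_induct)
  case base
  show ?case by (rule assms(3))
next
  case (step i)
  thus ?case
    using assms(2)[of i] singular[of d i out] no_recurrence[of d i out] by (cases "Determinant.det (mrank_mat d i) = 0") auto
qed

text \<open>Loop steps pass the outcome on unchanged, so a returned value stems from the final rule
  at counter \<open>s\<close>. Reaching it takes induction over the run instead of a single
  inversion.\<close>

lemma mrank_run_ReturnD:
  assumes "mrank_run d s0 (Return s \<alpha>)"
  obtains \<beta> W where "linear_recurrence 0 d s (mrank_coeffs d s)"
    "bij_betw \<beta> {..<s} {z. poly (characteristic_poly s (mrank_coeffs d s)) z = 0}"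
    "mat_inverse (vdm' s \<beta>) = Some W" "\<alpha> = transpose_mat W *\<^sub>v mrank_vec d s 0"
proof -
  have "\<exists>\<beta> W. linear_recurrence 0 d s (mrank_coeffs d s) \<and>
    bij_betw \<beta> {..<s} {z. poly (characteristic_poly s (mrank_coeffs d s)) z = 0} \<and>
    mat_inverse (vdm' s \<beta>) = Some W \<and> \<alpha> = transpose_mat W *\<^sub>v mrank_vec d s 0"
    using assms by (induction s0 "Return s \<alpha>" rule: mrank_run.induct) auto
  thus ?thesis
    using that by blast
qed

text \<open>Multiplying by the transposed matrix turns the output formula into an interpolation
  problem for the first \<open>s\<close> terms. The exponents start at 1 because the algorithm is
  run on \<open>c\<close> shifted by one.\<close>

lemma mrank_weights:
  assumes "mat_inverse (vdm' s \<beta>) = Some W" "\<alpha> \<in> carrier_vec s"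
  shows "\<alpha> = transpose_mat W *\<^sub>v mrank_vec d s 0 \<longleftrightarrow>
    (\<forall>n<s. d n = (\<Sum>i<s. vec_index \<alpha> i * \<beta> i ^ Suc n))"
proof -
  have W: "vdm' s \<beta> * W = 1\<^sub>m s" "W * vdm' s \<beta> = 1\<^sub>m s" "W \<in> carrier_mat s s"
    using mat_inverse(2)[OF vdm'_carrier assms(1)] by auto
  have WT: "transpose_mat W * transpose_mat (vdm' s \<beta>) = 1\<^sub>m s"
    "transpose_mat (vdm' s \<beta>) * transpose_mat W = 1\<^sub>m s"
    by (simp_all add: W(1,2) transpose_mult[OF vdm'_carrier W(3), symmetric]
        transpose_mult[OF W(3) vdm'_carrier, symmetric])
  have carr: "transpose_mat W \<in> carrier_mat s s" "transpose_mat (vdm' s \<beta>) \<in> carrier_mat s s"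
    "mrank_vec d s 0 \<in> carrier_vec s"
    using W(3) by (simp_all add: mrank_vec_def)
  have "\<alpha> = transpose_mat W *\<^sub>v mrank_vec d s 0 \<longleftrightarrow>
      transpose_mat (vdm' s \<beta>) *\<^sub>v \<alpha> = mrank_vec d s 0" (is "?l \<longleftrightarrow> ?r")
  proof
    assume ?l
    thus ?r
      using assoc_mult_mat_vec[OF carr(2,1,3)] WT(2) carr(3) by simp
  next
    assume r: ?r
    show ?l
      unfolding r[symmetric] using assoc_mult_mat_vec[OF carr(1,2) assms(2)] WT(1) assms(2) by simp
  qed
  also have "\<dots> \<longleftrightarrow> (\<forall>n<s. vec_index (transpose_mat (vdm' s \<beta>) *\<^sub>v \<alpha>) n = d n)"
    using carr by (auto simp: vec_eq_iff mrank_vec_def simp del: index_mult_mat_vec)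
  also have "\<dots> \<longleftrightarrow> (\<forall>n<s. d n = (\<Sum>i<s. vec_index \<alpha> i * \<beta> i ^ Suc n))"
  proof -
    have "vec_index (transpose_mat (vdm' s \<beta>) *\<^sub>v \<alpha>) n = (\<Sum>i<s. vec_index \<alpha> i * \<beta> i ^ Suc n)"
      if "n < s" for n
      using that assms(2)
      by (auto simp: vdm'_def scalar_prod_def atLeast0LessThan mult_ac intro!: sum.cong)
    thus ?thesis by auto
  qed
  finally show ?thesis .
qed

text \<open>The nonzero leading coefficient lets each term be computed from the \<open>s\<close>
  preceding ones.\<close>

lemma recurrence_determines_sequence:
  fixes d e :: "nat \<Rightarrow> complex"
  assumes "a s \<noteq> 0" "\<And>n. n < s \<Longrightarrow> d n = e n"
    and "\<And>t. (\<Sum>j\<le>s. a j * d (j + t)) = 0" "\<And>t. (\<Sum>j\<le>s. a j * e (j + t)) = 0"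
  shows "d n = e n"
proof (induction n rule: less_induct)
  case (less n)
  show ?case
  proof (cases "n < s")
    case False
    then obtain t where n: "n = s + t"
      using le_Suc_ex by (metis not_less)
    have "(\<Sum>j<s. a j * d (j + t)) = (\<Sum>j<s. a j * e (j + t))"
      using less.IH n by (intro sum.cong) auto
    moreover have "(\<Sum>j<s. a j * d (j + t)) + a s * d (s + t) = 0"
      "(\<Sum>j<s. a j * e (j + t)) + a s * e (s + t) = 0"
      using assms(3)[of t] assms(4)[of t] by (simp_all only: lessThan_Suc_atMost[symmetric] sum.lessThan_Suc)
    ultimately have "a s * d (s + t) = a s * e (s + t)"
      by (simp only: add_eq_0_iff)
    thus ?thesis
      using assms(1) n by simp
  qed (use assms(2) in auto)
qed

text \<open>Forwards, \<open>k\<close>, the number of distinct nodes, is the smallest order of a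
  recurrence, so the run returns there, with the multiplicities as its vector. Backwards, the
  returned vector gives a power sum that agrees with the sequence on \<open>s\<close> terms, and the
  recurrence extends the agreement.\<close>

lemma has_unitary_rank_iff_MRANK:
  assumes "r > 0"
  shows "has_unitary_rank c r \<longleftrightarrow>
        (\<exists>r' \<alpha>. MRANK (\<lambda>n. c (n + 1)) (Return r' \<alpha>) \<and>
           (\<forall>i<r'. vec_index \<alpha> i \<in> \<nat>) \<and>
           scalar_prod \<alpha> (Matrix.vec r' (\<lambda>_. 1)) = of_nat r)" (is "_ \<longleftrightarrow> ?R")
proof
  assume "has_unitary_rank c r"
  then obtain k and \<beta> :: "nat \<Rightarrow> complex" and \<alpha> :: "nat \<Rightarrow> nat" where
    inj: "inj_on \<beta> {..<k}" and "k > 0" and nz: "\<forall>i<k. \<beta> i \<noteq> 0" "\<forall>i<k. \<alpha> i > 0"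
    and sum: "(\<Sum>i<k. \<alpha> i) = r" and c: "\<forall>n\<ge>1. c n = (\<Sum>i<k. of_nat (\<alpha> i) * \<beta> i ^ n)"
    by (rule has_unitary_rank_enum)
  define d where "d n = c (n + 1)" for n
  define S where "S = \<beta> ` {..<k}"
  \<comment> \<open>The shift to \<open>d\<close> multiplies each weight by its nonzero node; the
    inverse of \<open>\<beta>\<close> moves the weights from indices to nodes.\<close>
  define w where "w z = of_nat (\<alpha> (the_inv_into {..<k} \<beta> z)) * z" for z
  have S: "finite S" "card S = k"
    using inj by (simp_all add: S_def card_image)
  have w: "w (\<beta> i) = of_nat (\<alpha> i) * \<beta> i" if "i < k" for i
    using the_inv_into_f_f[OF inj] that by (simp add: w_def)
  have w_nz: "w z \<noteq> 0" if "z \<in> S" for z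
    using that nz w by (auto simp: S_def)
  have d_sum: "d n = (\<Sum>i<k. of_nat (\<alpha> i) * \<beta> i ^ Suc n)" for n
    using c by (simp add: d_def)
  have d: "d n = (\<Sum>z\<in>S. w z * z ^ n)" for n
    using inj w by (simp add: S_def sum.reindex d_sum mult.assoc)
  have det: "Determinant.det (mrank_mat d k) \<noteq> 0"
    by (rule det_mrank_mat_nonzero[OF S w_nz d])
  define p where "p = (\<Prod>z\<in>S. [:- z, 1:])"
  have p_deg: "degree p = k"
    using S by (simp add: p_def degree_prod_sum_eq)
  have p_lead: "coeff p k = 1"
    using lead_coeff_prod[of "\<lambda>z. [:- z, 1:]" S] p_deg by (simp add: p_def)
  have p_char: "characteristic_poly k (coeff p) = p"
    using p_deg by (rule characteristic_poly_coeff)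
  have roots: "{z. poly p z = 0} = S"
    using S(1) by (auto simp: p_def poly_prod)
  have rec: "(\<Sum>j\<le>k. coeff p j * d (j + t)) = 0" for t
    using roots recurrence_sum_of_powers[of k d t w "\<lambda>z. z" S "coeff p"] d
    by (auto simp: p_char intro!: sum.neutral)
  have coeffs: "mrank_coeffs d k j = coeff p j" if "j \<le> k" for j
    using that rec by (intro mrank_coeffs_eqI[where a = "coeff p", OF det p_lead])
  have char: "characteristic_poly k (mrank_coeffs d k) = p"
    using coeffs p_char by (simp add: characteristic_poly_def)
  obtain W where W: "mat_inverse (vdm' k \<beta>) = Some W"
    using mat_inverse_of_det_nonzero[OF vdm'_carrier det_vdm'_nonzero[OF inj]] nz(1) by metis
  let ?\<alpha> = "Matrix.vec k (\<lambda>i. of_nat (\<alpha> i))"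
  have "mrank_run d k (Return k (transpose_mat W *\<^sub>v mrank_vec d k 0))"
  proof (rule mrank_run.return[OF det _ _ _ W])
    show "linear_recurrence 0 d k (mrank_coeffs d k)"
      using rec coeffs p_lead by (simp add: linear_recurrence_def)
    show "rsquarefree (characteristic_poly k (mrank_coeffs d k))"
      unfolding char unfolding p_def by (rule rsquarefree_prod_linear[OF S(1)])
    show "bij_betw \<beta> {..<k} {z. poly (characteristic_poly k (mrank_coeffs d k)) z = 0}"
      unfolding char roots S_def using inj by (simp add: bij_betw_def)
  qed
  moreover have "?\<alpha> = transpose_mat W *\<^sub>v mrank_vec d k 0"
    by (subst mrank_weights[OF W]) (simp_all add: d_sum)
  ultimately have "mrank_run d k (Return k ?\<alpha>)"
    by simp
  hence "mrank_run d 1 (Return k ?\<alpha>)"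
    using no_short_linear_recurrence[OF S(1) w_nz d] S(2) \<open>k > 0\<close> by (intro mrank_run_skip[of 1 k]) auto
  moreover have "scalar_prod ?\<alpha> (Matrix.vec k (\<lambda>_. 1)) = of_nat r"
    by (simp add: scalar_prod_def atLeast0LessThan flip: sum)
  ultimately show ?R
    by (intro exI[of _ k] exI[of _ ?\<alpha>]) (simp add: MRANK_def d_def[abs_def])
next
  assume ?R
  then obtain s \<alpha> where run: "MRANK (\<lambda>n. c (n + 1)) (Return s \<alpha>)"
    and \<alpha>: "\<forall>i<s. vec_index \<alpha> i \<in> \<nat>" "scalar_prod \<alpha> (Matrix.vec s (\<lambda>_. 1)) = of_nat r"
    by blast
  define d where "d n = c (n + 1)" for n
  have "mrank_run d 1 (Return s \<alpha>)"
    using run by (simp add: MRANK_def d_def[abs_def])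
  then obtain \<beta> W where rec: "linear_recurrence 0 d s (mrank_coeffs d s)"
    and \<beta>: "bij_betw \<beta> {..<s} {z. poly (characteristic_poly s (mrank_coeffs d s)) z = 0}"
    and W: "mat_inverse (vdm' s \<beta>) = Some W" and \<alpha>_eq: "\<alpha> = transpose_mat W *\<^sub>v mrank_vec d s 0"
    by (rule mrank_run_ReturnD)
  have W': "vdm' s \<beta> * W = 1\<^sub>m s" "W \<in> carrier_mat s s"
    using mat_inverse(2)[OF vdm'_carrier W] by auto
  have carr: "\<alpha> \<in> carrier_vec s"
    using W'(2) \<alpha>_eq by (auto simp: mrank_vec_def)
  \<comment> \<open>A zero root would give the invertible matrix \<open>vdm' s \<beta>\<close> a
    zero row.\<close>
  have \<beta>_nz: "\<beta> i \<noteq> 0" if "i < s" for i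
  proof
    assume "\<beta> i = 0"
    hence "(vdm' s \<beta> * W) $$ (i, i) = 0"
      using that W'(2) by (auto simp: vdm'_def scalar_prod_def intro!: sum.neutral)
    thus False
      using that by (simp add: W'(1))
  qed
  define e where "e n = (\<Sum>i<s. vec_index \<alpha> i * \<beta> i ^ Suc n)" for n
  have root: "poly (characteristic_poly s (mrank_coeffs d s)) (\<beta> i) = 0" if "i < s" for i
    using bij_betw_apply[OF \<beta>, of i] that by simp
  have d: "d n = e n" for n
  proof (rule recurrence_determines_sequence[of "mrank_coeffs d s" s])
    show "d n = e n" if "n < s" for n
      using that mrank_weights[OF W carr, of d] \<alpha>_eq by (simp add: e_def)
    show "(\<Sum>j\<le>s. mrank_coeffs d s j * e (j + t)) = 0" for t
      using root recurrence_sum_of_powers[of s e t "\<lambda>i. vec_index \<alpha> i * \<beta> i" \<beta> "{..<s}" "mrank_coeffs d s"]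
      by (simp add: e_def mult.assoc)
  qed (use rec in \<open>auto simp: linear_recurrence_def\<close>)
  have "\<forall>i<s. \<exists>m. vec_index \<alpha> i = of_nat m"
    using \<alpha>(1) by (auto elim: Nats_cases)
  then obtain m where m: "\<And>i. i < s \<Longrightarrow> vec_index \<alpha> i = of_nat (m i)"
    by metis
  show "has_unitary_rank c r"
  proof (rule has_unitary_rankI[OF assms, of "{..<s}" \<beta> m])
    have "of_nat (\<Sum>i<s. m i) = (of_nat r :: complex)"
      using \<alpha>(2) m by (simp add: scalar_prod_def atLeast0LessThan)
    thus "(\<Sum>i<s. m i) = r"
      unfolding of_nat_eq_iff .
    show "c n = (\<Sum>i<s. of_nat (m i) * \<beta> i ^ n)" if "n \<ge> 1" for n
      using d[of "n - 1"] that m by (simp add: d_def e_def del: power_Suc)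
  qed (use \<beta>_nz in auto)
qed

section \<open>The exponential of the integrated generating function\<close>

text \<open>The coefficient at \<open>Suc m\<close> is determined by those up to \<open>m\<close>,
  since characteristic 0 permits division by \<open>Suc m\<close>.\<close>

lemma fps_deriv_eq_mult_unique:
  fixes f g G :: "'a::field_char_0 fps"
  assumes "fps_deriv f = G * f" "fps_deriv g = G * g" "fps_nth f 0 = fps_nth g 0"
  shows "f = g"
proof (rule fps_ext)
  fix n
  show "fps_nth f n = fps_nth g n"
  proof (induction n rule: less_induct)
    case (less n)
    show ?case
    proof (cases n)
      case (Suc m)
      have "of_nat (Suc m) * fps_nth f (Suc m) = fps_nth (G * f) m"
        using assms(1) by (metis fps_deriv_nth Suc_eq_plus1)
      also have "\<dots> = fps_nth (G * g) m"
        using less.IH Suc by (auto simp: fps_mult_nth intro!: sum.cong)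
      also have "\<dots> = of_nat (Suc m) * fps_nth g (Suc m)"
        using assms(2) by (metis fps_deriv_nth Suc_eq_plus1)
      finally show ?thesis
        using Suc by (simp del: of_nat_Suc)
    qed (use assms(3) in simp)
  qed
qed

lemma fps_deriv_fps_exponential: "fps_deriv (fps_exponential F) = fps_deriv F * fps_exponential F"
  by (simp add: fps_exponential_def fps_compose_deriv mult_ac)

lemma fps_nth_fps_exponential_0: "fps_nth (fps_exponential F) 0 = exp (fps_nth F 0)"
  by (simp add: fps_exponential_def)

text \<open>The logarithmic derivative is additive over the factors, and each factor contributes
  minus a geometric series.\<close>

lemma fps_deriv_prod_linear:
  fixes \<beta> :: "'b \<Rightarrow> 'a::field_char_0"
  assumes "finite I"
  shows "fps_deriv (\<Prod>i\<in>I. fps_of_poly [:1, - \<beta> i:])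
    = - Abs_fps (\<lambda>n. \<Sum>i\<in>I. \<beta> i ^ Suc n) * (\<Prod>i\<in>I. fps_of_poly [:1, - \<beta> i:])"
  using assms
proof (induction rule: finite_induct)
  case empty
  have "Abs_fps (\<lambda>n. 0) = (0 :: 'a fps)"
    by (simp add: fps_eq_iff)
  thus ?case by simp
next
  case (insert x I)
  let ?P = "\<Prod>i\<in>I. fps_of_poly [:1, - \<beta> i:]" and ?f = "fps_of_poly [:1, - \<beta> x:]"
  let ?A = "Abs_fps (\<lambda>n. \<Sum>i\<in>I. \<beta> i ^ Suc n)" and ?B = "Abs_fps (\<lambda>n. \<beta> x ^ Suc n)"
  have f: "?f = 1 - fps_const (\<beta> x) * fps_X"
    by (simp add: fps_of_poly_linear' flip: fps_const_neg)
  \<comment> \<open>The geometric series \<open>?B\<close> is the quotient of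
    \<open>fps_const (\<beta> x)\<close> by \<open>?f\<close>.\<close>
  have B: "?B * ?f = fps_const (\<beta> x)"
  proof -
    have "?B * ?f = ?B - fps_const (\<beta> x) * (?B * fps_X)"
      unfolding f by (simp add: algebra_simps del: power_Suc)
    thus ?thesis
      by (auto simp: fps_eq_iff not0_implies_Suc split: nat.splits) (metis Suc_pred power_Suc)
  qed
  have f': "fps_deriv ?f = - ?B * ?f"
    unfolding mult_minus_left B by (simp add: f)
  have AB: "Abs_fps (\<lambda>n. \<Sum>i\<in>insert x I. \<beta> i ^ Suc n) = ?B + ?A"
    using insert.hyps by (simp add: fps_eq_iff)
  have "fps_deriv (?f * ?P) = - ?B * ?f * ?P + ?f * (- ?A * ?P)"
    unfolding fps_deriv_mult f' insert.IH by simp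
  also have "\<dots> = - (?B + ?A) * (?f * ?P)"
    by (simp add: algebra_simps)
  finally show ?case
    using insert.hyps unfolding AB by simp
qed

lemma poly_prod_linear_0:
  fixes \<beta> :: "'b \<Rightarrow> 'a::field"
  assumes "finite I"
  shows "poly (\<Prod>i\<in>I. [:1, - \<beta> i:]) 0 = 1"
  using assms by (simp add: poly_prod)

text \<open>The exponential solves \<open>F' = G F\<close>, where \<open>G\<close> has the
  coefficients \<open>- c (Suc n)\<close>. A product of factors \<open>1 - \<beta> i X\<close>
  solves it exactly when the \<open>c n\<close> are the power sums of the \<open>\<beta> i\<close>.
  Different constants of integration only rescale by \<open>exp C\<close>.\<close>

lemma has_unitary_rank_iff_exponential:
  assumes "r > 0"
  shows "has_unitary_rank c r \<longleftrightarrow>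
        (\<forall>C. \<exists>p :: complex poly.
           fps_exponential (fps_integral (- (ogf c / fps_X)) C) = fps_of_poly p \<and>
           degree p = r \<and> (\<forall>z. poly p z = 0 \<longrightarrow> z \<noteq> 0))" (is "_ \<longleftrightarrow> ?R")
proof -
  define G where "G = - (ogf c / fps_X)"
  have G: "fps_nth G n = - c (Suc n)" for n
    by (simp add: G_def ogf_def)
  define E where "E C = fps_exponential (fps_integral G C)" for C
  have E0: "fps_nth (E C) 0 = exp C" for C
    by (simp add: E_def fps_nth_fps_exponential_0)
  have E': "fps_deriv (E C) = G * E C" for C
    by (simp add: E_def fps_deriv_fps_exponential fps_deriv_fps_integral)
  show ?thesis
    unfolding G_def[symmetric] E_def[symmetric]
  proof
    assume "has_unitary_rank c r"
    then obtain \<beta> where \<beta>: "\<forall>i<r. \<beta> i \<noteq> 0" "\<forall>n\<ge>1. c n = (\<Sum>i<r. \<beta> i ^ n)"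
      using has_unitary_rank_iff_power_sums[OF assms] by auto
    have G_eq: "G = - Abs_fps (\<lambda>n. \<Sum>i<r. \<beta> i ^ Suc n)"
      using \<beta>(2) by (simp add: fps_eq_iff G)
    show "\<forall>C. \<exists>p. E C = fps_of_poly p \<and> degree p = r \<and> (\<forall>z. poly p z = 0 \<longrightarrow> z \<noteq> 0)"
    proof
      fix C
      let ?q = "\<Prod>i<r. [:1, - \<beta> i:]"
      let ?p = "Polynomial.smult (exp C) ?q"
      have q0: "poly ?q 0 = 1"
        by (rule poly_prod_linear_0) simp
      have p: "fps_of_poly ?p = fps_const (exp C) * (\<Prod>i<r. fps_of_poly [:1, - \<beta> i:])"
        by (simp only: fps_of_poly_smult fps_of_poly_prod)
      have "E C = fps_of_poly ?p"
      proof (rule fps_deriv_eq_mult_unique)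
        show "fps_deriv (fps_of_poly ?p) = G * fps_of_poly ?p"
          unfolding p G_eq
          by (subst fps_deriv_mult, subst fps_deriv_prod_linear)
             (simp_all only: finite_lessThan fps_deriv_const mult_zero_left add_0_right mult.left_commute)
        show "fps_nth (E C) 0 = fps_nth (fps_of_poly ?p) 0"
          using q0 by (simp add: E0 poly_0_coeff_0)
      qed (rule E')
      \<comment> \<open>Each factor has degree exactly 1 as \<open>\<beta> i \<noteq> 0\<close>, and
        the scalar \<open>exp C\<close> does not vanish.\<close>
      moreover have "degree ?p = r"
        using \<beta>(1) by (simp add: degree_prod_sum_eq)
      moreover have "z \<noteq> 0" if "poly ?p z = 0" for z
        using q0 that by auto
      ultimately show "\<exists>p. E C = fps_of_poly p \<and> degree p = r \<and> (\<forall>z. poly p z = 0 \<longrightarrow> z \<noteq> 0)"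
        by blast
    qed
  next
    assume "\<forall>C. \<exists>p. E C = fps_of_poly p \<and> degree p = r \<and> (\<forall>z. poly p z = 0 \<longrightarrow> z \<noteq> 0)"
    then obtain p where p: "E 0 = fps_of_poly p" "degree p = r" "\<forall>z. poly p z = 0 \<longrightarrow> z \<noteq> 0"
      by blast
    obtain root where root: "Polynomial.smult (lead_coeff p) (\<Prod>i<r. [:- root i, 1:]) = p"
      using complex_poly_decompose'[of p] p(2) by metis
    have root_nz: "root i \<noteq> 0" if "i < r" for i
    proof -
      have "poly p (root i) = 0"
        using that by (subst root[symmetric]) (auto simp: poly_prod)
      thus ?thesis using p(3) by auto
    qed
    \<comment> \<open>Since the roots are nonzero, each factor \<open>X - root i\<close> is a
      multiple of \<open>1 - \<beta> i X\<close>, so the nodes are the reciprocals of the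
      roots.\<close>
    define \<beta> where "\<beta> i = 1 / root i" for i
    define K where "K = lead_coeff p * (\<Prod>i<r. - root i)"
    have "(\<Prod>i<r. [:- root i, 1:]) = (\<Prod>i<r. Polynomial.smult (- root i) [:1, - \<beta> i:])"
      using root_nz by (intro prod.cong) (auto simp: \<beta>_def)
    also have "\<dots> = Polynomial.smult (\<Prod>i<r. - root i) (\<Prod>i<r. [:1, - \<beta> i:])"
      by (rule prod_smult)
    finally have "p = Polynomial.smult K (\<Prod>i<r. [:1, - \<beta> i:])"
      using root by (simp add: K_def)
    hence E_eq: "E 0 = fps_const K * (\<Prod>i<r. fps_of_poly [:1, - \<beta> i:])"
      unfolding p(1) by (simp only: fps_of_poly_smult fps_of_poly_prod)
    have "fps_deriv (E 0) = - Abs_fps (\<lambda>n. \<Sum>i<r. \<beta> i ^ Suc n) * E 0"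
      unfolding E_eq
      by (subst fps_deriv_mult, subst fps_deriv_prod_linear)
         (simp_all only: finite_lessThan fps_deriv_const mult_zero_left add_0_right mult.left_commute)
    hence "G * E 0 = - Abs_fps (\<lambda>n. \<Sum>i<r. \<beta> i ^ Suc n) * E 0"
      by (simp only: E')
    \<comment> \<open>The constant term of \<open>E 0\<close> is \<open>exp 0\<close>, so
      \<open>E 0\<close> can be cancelled and the logarithmic derivatives agree.\<close>
    moreover have "E 0 \<noteq> 0"
      using E0[of 0] by auto
    ultimately have "G = - Abs_fps (\<lambda>n. \<Sum>i<r. \<beta> i ^ Suc n)"
      by (simp only: mult_cancel_right) simp
    hence "- c (Suc n) = - (\<Sum>i<r. \<beta> i ^ Suc n)" for n
      unfolding G[symmetric] by simp
    hence "c n = (\<Sum>i<r. \<beta> i ^ n)" if "n \<ge> 1" for n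
      using that by (cases n) (auto simp del: power_Suc)
    moreover have "\<beta> i \<noteq> 0" if "i < r" for i
      using root_nz[OF that] by (simp add: \<beta>_def)
    ultimately show "has_unitary_rank c r"
      using has_unitary_rank_iff_power_sums[OF assms] by blast
  qed
qed

section \<open>Finite-atomic measures\<close>

text \<open>Point masses on \<open>A\<close>, moved from the power set of \<open>A\<close> to the
  Borel sets so as to be comparable with \<open>positive_part borel\<close>.\<close>

definition atoms_measure :: "'a::t1_space set \<Rightarrow> ('a \<Rightarrow> nat) \<Rightarrow> 'a measure" where
  "atoms_measure A m = distr (point_measure A (\<lambda>x. real (m x))) borel (\<lambda>x. x)"

lemma emeasure_atoms_measure:
  assumes "finite A" "E \<in> sets borel"
  shows "emeasure (atoms_measure A m) E = ennreal (\<Sum>x\<in>A. if x \<in> E then real (m x) else 0)"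
proof -
  have "emeasure (atoms_measure A m) E = (\<Sum>x\<in>E \<inter> A. ennreal (real (m x)))"
    using assms by (simp add: atoms_measure_def emeasure_distr space_point_measure emeasure_point_measure_finite)
  also have "\<dots> = ennreal (\<Sum>x\<in>E \<inter> A. real (m x))"
    by (simp add: sum_ennreal)
  also have "(\<Sum>x\<in>E \<inter> A. real (m x)) = (\<Sum>x\<in>A. if x \<in> E then real (m x) else 0)"
    using assms(1) by (subst sum.inter_filter[symmetric]) (auto intro!: sum.cong)
  finally show ?thesis .
qed

lemma integral_atoms_measure:
  fixes f :: "'a::t1_space \<Rightarrow> complex"
  assumes "finite A" "f \<in> borel_measurable borel"
  shows "integrable (atoms_measure A m) f" "integral\<^sup>L (atoms_measure A m) f = (\<Sum>x\<in>A. of_nat (m x) * f x)"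
  using assms
  by (simp_all add: atoms_measure_def integrable_distr_eq integral_distr integrable_point_measure_finite
      lebesgue_integral_point_measure_finite scaleR_conv_of_real)

text \<open>\<open>measure_of\<close> depends only on the values of the set function on the
  sigma-algebra, so once these match a known measure, additivity of the supremum comes for
  free.\<close>

lemma positive_part_eqI:
  assumes "sets N = sets M" "\<And>E. E \<in> sets M \<Longrightarrow> (SUP B\<in>{B \<in> sets M. B \<subseteq> E}. ennreal (\<nu> B)) = emeasure N E"
  shows "positive_part M \<nu> = N"
proof -
  have "positive_part M \<nu> = measure_of (space M) (sets M) (emeasure N)"
    unfolding positive_part_def
    by (rule measure_of_eq) (use assms(2) sets.space_closed in \<open>auto simp: sets.sigma_sets_eq\<close>)
  also have "\<dots> = N"
    using measure_of_of_measure[of N] assms(1) sets_eq_imp_space_eq[OF assms(1)] by simp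
  finally show ?thesis .
qed

text \<open>Nonnegative weights make \<open>\<nu>\<close> monotone, so the supremum is attained at
  \<open>E\<close> itself.\<close>

lemma positive_part_atoms:
  fixes A :: "'a::t1_space set"
  assumes "finite A" "\<And>B. B \<in> sets borel \<Longrightarrow> \<nu> B = (\<Sum>x\<in>A. if x \<in> B then real (m x) else 0)"
  shows "positive_part borel \<nu> = atoms_measure A m"
proof (rule positive_part_eqI)
  fix E :: "'a set" assume E: "E \<in> sets borel"
  have "ennreal (\<nu> B) \<le> ennreal (\<nu> E)" if "B \<in> sets borel" "B \<subseteq> E" for B
    using that E assms(2) by (intro ennreal_leI) (auto intro!: sum_mono)
  hence "(SUP B\<in>{B \<in> sets borel. B \<subseteq> E}. ennreal (\<nu> B)) = ennreal (\<nu> E)"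
    using E by (intro antisym SUP_least SUP_upper) auto
  thus "(SUP B\<in>{B \<in> sets borel. B \<subseteq> E}. ennreal (\<nu> B)) = emeasure (atoms_measure A m) E"
    using E assms by (simp add: emeasure_atoms_measure)
qed (simp add: atoms_measure_def)

lemma positive_part_nonpos:
  assumes "\<And>B. B \<in> sets M \<Longrightarrow> \<nu> B \<le> 0"
  shows "positive_part M \<nu> = null_measure M"
proof (rule positive_part_eqI)
  fix E assume "E \<in> sets M"
  hence "(SUP B\<in>{B \<in> sets M. B \<subseteq> E}. ennreal (\<nu> B)) = (SUP B\<in>{B \<in> sets M. B \<subseteq> E}. 0)"
    using assms by (intro SUP_cong) (auto simp: ennreal_neg)
  also have "\<dots> = 0"
    by (simp add: SUP_constant bot_ennreal)
  finally show "(SUP B\<in>{B \<in> sets M. B \<subseteq> E}. ennreal (\<nu> B)) = emeasure (null_measure M) E"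
    by simp
qed simp

lemma has_complex_measure_integral_atoms:
  fixes f :: "'a::t1_space \<Rightarrow> complex"
  assumes "finite A" "f \<in> borel_measurable borel"
    and "\<And>B. B \<in> sets borel \<Longrightarrow> \<mu> B = (\<Sum>x\<in>A. if x \<in> B then of_nat (m x) else 0)"
  shows "has_complex_measure_integral borel \<mu> f I \<longleftrightarrow> I = (\<Sum>x\<in>A. of_nat (m x) * f x)"
proof -
  have \<mu>: "\<mu> B = of_real (\<Sum>x\<in>A. if x \<in> B then real (m x) else 0)" if "B \<in> sets borel" for B
    using assms(3)[OF that] by (simp add: if_distrib cong: if_cong)
  have "positive_part borel (\<lambda>E. Re (\<mu> E)) = atoms_measure A m"
    using assms(1) \<mu> by (intro positive_part_atoms) simp_all
  moreover have "positive_part borel (\<lambda>E. - Re (\<mu> E)) = null_measure borel"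
    "positive_part borel (\<lambda>E. Im (\<mu> E)) = null_measure borel"
    "positive_part borel (\<lambda>E. - Im (\<mu> E)) = null_measure borel"
    using \<mu> by (auto intro!: positive_part_nonpos sum_nonneg simp del: of_real_sum)
  ultimately show ?thesis
    using assms(1,2) by (simp add: has_complex_measure_integral_def Let_def integral_atoms_measure)
qed

text \<open>The sequence consisting of \<open>B\<close>, \<open>C\<close> and then empty sets
  reduces finite to countable additivity, as the empty set has value 0.\<close>

lemma complex_measure_Un:
  assumes "complex_measure M \<mu>" "B \<in> sets M" "C \<in> sets M" "B \<inter> C = {}"
  shows "\<mu> (B \<union> C) = \<mu> B + \<mu> C"
proof -
  have "range (binaryset B C) \<subseteq> sets M" "disjoint_family (binaryset B C)"
    using assms(2-4) by (auto simp: range_binaryset_eq disjoint_family_on_def binaryset_def)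
  hence "(\<lambda>i. \<mu> (binaryset B C i)) sums \<mu> (B \<union> C)"
    using assms(1) UN_binaryset_eq[of B C] unfolding complex_measure_def by metis
  moreover have "(\<lambda>i. \<mu> (binaryset B C i)) sums (\<mu> B + \<mu> C)"
    using assms(1) by (intro binaryset_sums) (simp add: complex_measure_def)
  ultimately show ?thesis
    by (rule sums_unique2)
qed

lemma complex_measure_finite_set:
  assumes "complex_measure M \<mu>" "finite F" "\<And>x. x \<in> F \<Longrightarrow> {x} \<in> sets M"
  shows "F \<in> sets M \<and> \<mu> F = (\<Sum>x\<in>F. \<mu> {x})"
  using assms(2,3)
proof (induction rule: finite_induct)
  case empty
  show ?case using assms(1) by (simp add: complex_measure_def)
next
  case (insert x F)
  hence "{x} \<union> F \<in> sets M"
    by (intro sets.Un) auto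
  moreover have "\<mu> ({x} \<union> F) = \<mu> {x} + \<mu> F"
    using insert by (intro complex_measure_Un[OF assms(1)]) auto
  ultimately show ?case
    using insert by simp
qed

text \<open>\<open>B\<close> splits into its finitely many atoms and a rest disjoint from
  \<open>A\<close>, which has value 0.\<close>

lemma finite_atomic_eq_sum:
  assumes "complex_measure M \<mu>" "finite_atomic M \<mu> A" "B \<in> sets M"
  shows "\<mu> B = (\<Sum>x\<in>A. if x \<in> B then \<mu> {x} else 0)"
proof -
  have A: "finite A" "\<And>x. x \<in> A \<Longrightarrow> {x} \<in> sets M"
    "\<And>B. B \<in> sets M \<Longrightarrow> B \<inter> A = {} \<Longrightarrow> \<mu> B = 0"
    using assms(2) by (auto simp: finite_atomic_def)
  have fin: "A \<inter> B \<in> sets M" "\<mu> (A \<inter> B) = (\<Sum>x\<in>A \<inter> B. \<mu> {x})"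
    using complex_measure_finite_set[OF assms(1), of "A \<inter> B"] A by auto
  have "\<mu> B = \<mu> ((A \<inter> B) \<union> (B - A \<inter> B))"
    by (rule arg_cong[of _ _ \<mu>]) auto
  also have "\<dots> = \<mu> (A \<inter> B) + \<mu> (B - A \<inter> B)"
    using fin(1) assms(3) by (intro complex_measure_Un[OF assms(1)]) auto
  also have "\<mu> (B - A \<inter> B) = 0"
    using fin(1) assms(3) by (intro A(3)) auto
  finally show ?thesis
    using fin(2) A(1) by (simp add: sum.inter_restrict)
qed

text \<open>Disjointness puts each \<open>x\<close> into at most one set of the family, so its
  series has at most one nonzero term; finitely many such series are added.\<close>

lemma complex_measure_atoms:
  fixes w :: "'a \<Rightarrow> complex"
  assumes "finite A"
  shows "complex_measure M (\<lambda>B. \<Sum>x\<in>A. if x \<in> B then w x else 0)"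
  unfolding complex_measure_def
proof (intro conjI allI impI)
  fix B :: "nat \<Rightarrow> 'a set" assume "disjoint_family B"
  hence "(\<lambda>i. if x \<in> B i then w x else 0) sums (if x \<in> (\<Union>i. B i) then w x else 0)" for x
  proof (cases "x \<in> (\<Union>i. B i)")
    case True
    then obtain j where j: "x \<in> B j" by auto
    have "x \<in> B i \<longleftrightarrow> i = j" for i
      using \<open>disjoint_family B\<close> j by (auto simp: disjoint_family_on_def)
    hence "(\<lambda>i. if x \<in> B i then w x else 0) = (\<lambda>i. if i = j then w x else 0)"
      by simp
    thus ?thesis
      using True sums_single[of j "\<lambda>_. w x"] by simp
  qed simp
  thus "(\<lambda>i. \<Sum>x\<in>A. if x \<in> B i then w x else 0) sums (\<Sum>x\<in>A. if x \<in> (\<Union>i. B i) then w x else 0)"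
    by (intro sums_sum) auto
qed simp

text \<open>Atoms are the distinct nodes and masses their multiplicities, so the integral of
  \<open>x ^ n\<close> is the power sum.\<close>

lemma has_unitary_rank_iff_moments:
  assumes "r > 0"
  shows "has_unitary_rank c r \<longleftrightarrow>
        (\<exists>(\<mu> :: complex set \<Rightarrow> complex) A.
           complex_measure borel \<mu> \<and> finite_atomic borel \<mu> A \<and> 0 \<notin> A \<and>
           (\<forall>x\<in>A. \<mu> {x} \<in> \<nat> - {0}) \<and> (\<Sum>x\<in>A. \<mu> {x}) = of_nat r \<and>
           (\<forall>n\<ge>1. has_complex_measure_integral borel \<mu> (\<lambda>x. x ^ n) (c n)))" (is "_ \<longleftrightarrow> ?R")
proof
  assume "has_unitary_rank c r"
  then obtain S and m :: "complex \<Rightarrow> nat" where S: "finite S" "S \<noteq> {}" "0 \<notin> S" "\<forall>z\<in>S. m z > 0"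
    "sum m S = r" "\<forall>n\<ge>1. c n = (\<Sum>z\<in>S. of_nat (m z) * z ^ n)"
    by (rule has_unitary_rank_nodes)
  define \<mu> :: "complex set \<Rightarrow> complex" where "\<mu> B = (\<Sum>x\<in>S. if x \<in> B then of_nat (m x) else 0)" for B
  have atom: "\<mu> {x} = of_nat (m x)" if "x \<in> S" for x
    using that S(1) by (simp add: \<mu>_def sum.delta')
  have "complex_measure borel \<mu>"
    unfolding \<mu>_def by (rule complex_measure_atoms[OF S(1)])
  moreover have "finite_atomic borel \<mu> S"
    using S(1,4) atom by (auto simp: finite_atomic_def \<mu>_def intro!: sum.neutral)
  moreover have "(\<Sum>x\<in>S. \<mu> {x}) = of_nat r"
    using atom by (simp flip: S(5))
  moreover have "\<forall>n\<ge>1. has_complex_measure_integral borel \<mu> (\<lambda>x. x ^ n) (c n)"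
    using S(6) by (subst has_complex_measure_integral_atoms[OF S(1), where m = m]) (simp_all add: \<mu>_def)
  moreover have "\<forall>x\<in>S. \<mu> {x} \<in> \<nat> - {0}"
    using atom S(4) by auto
  ultimately show ?R
    using S(3) by blast
next
  assume ?R
  then obtain \<mu> A where *: "complex_measure borel \<mu>" "finite_atomic borel \<mu> A" "0 \<notin> A"
    "\<forall>x\<in>A. \<mu> {x} \<in> \<nat> - {0}" "(\<Sum>x\<in>A. \<mu> {x}) = of_nat r"
    and moment: "\<forall>n\<ge>1. has_complex_measure_integral borel \<mu> (\<lambda>x. x ^ n) (c n)"
    by blast
  have A: "finite A"
    using *(2) by (simp add: finite_atomic_def)
  have "\<forall>x\<in>A. \<exists>k. \<mu> {x} = of_nat k"
    using *(4) by (auto elim: Nats_cases)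
  then obtain m where m: "\<And>x. x \<in> A \<Longrightarrow> \<mu> {x} = of_nat (m x)"
    by metis
  show "has_unitary_rank c r"
  proof (rule has_unitary_rankI[OF assms A, of "\<lambda>x. x" m])
    have "of_nat (sum m A) = (of_nat r :: complex)"
      using *(5) m by simp
    thus "sum m A = r"
      unfolding of_nat_eq_iff .
    have "\<mu> B = (\<Sum>x\<in>A. if x \<in> B then of_nat (m x) else 0)" if "B \<in> sets borel" for B
      using finite_atomic_eq_sum[OF *(1,2) that] m by (simp cong: sum.cong if_cong)
    thus "c n = (\<Sum>x\<in>A. of_nat (m x) * x ^ n)" if "n \<ge> 1" for n
      using moment that has_complex_measure_integral_atoms[OF A, of "\<lambda>x. x ^ n" \<mu> m "c n"] by simp
  qed (use *(3) in auto)
qed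

section \<open>The equivalence\<close>

(* A zero among the parameters beta_i, a_i or a zero atom contributes to c'_0 = r or to the total
   mass, but to no c_n with n >= 1, so these are required to be nonzero, as in the definition of
   unitary rank. In the condition on binomial sums the weight of the ratio beta_j / alpha_j is
   lambda_j * alpha_j ^ (2 * r'); it is normalised to be the natural number alpha_j. Without these
   clauses the conditions do not imply unitary rank r. *)
theorem theorem2:
  fixes c :: "nat \<Rightarrow> complex" and r :: nat
  assumes "r > 0"
  shows
    "(has_unitary_rank c r \<longleftrightarrow>
        (\<exists>r' \<alpha>. MRANK (\<lambda>n. c (n + 1)) (Return r' \<alpha>) \<and>
           (\<forall>i<r'. vec_index \<alpha> i \<in> \<nat>) \<and>
           scalar_prod \<alpha> (Matrix.vec r' (\<lambda>_. 1)) = of_nat r))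
     \<and>
     (has_unitary_rank c r \<longleftrightarrow>
        (\<exists>r'\<le>r. \<exists>a \<beta>. \<exists>\<alpha> :: nat \<Rightarrow> nat.
           simple_recurrence 1 c r' a \<and>
           bij_betw \<beta> {..<r'} {z. poly (characteristic_poly r' a) z = 0} \<and>
           (\<forall>i<r'. \<beta> i \<noteq> 0) \<and>
           (\<forall>n\<ge>1. c n = (\<Sum>i<r'. of_nat (\<alpha> i) * \<beta> i ^ n)) \<and>
           (\<Sum>i<r'. \<alpha> i) = r))
     \<and>
     (has_unitary_rank c r \<longleftrightarrow>
        (\<exists>\<beta> :: nat \<Rightarrow> complex. (\<forall>i<r. \<beta> i \<noteq> 0) \<and>
           (\<forall>t. hankel_mat r (with_zeroth r c) t =
                transpose_mat (vdm r \<beta>) * (mat_diag r \<beta> ^\<^sub>m t) * vdm r \<beta>)))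
     \<and>
     (has_unitary_rank c r \<longleftrightarrow>
        (\<exists>a :: nat \<Rightarrow> complex. (\<forall>i<r. a i \<noteq> 0) \<and>
           hankel_inf (with_zeroth r c) = gram_inf r (vdm_inf a)))
     \<and>
     (has_unitary_rank c r \<longleftrightarrow>
        (\<forall>C. \<exists>p :: complex poly.
           fps_exponential (fps_integral (- (ogf c / fps_X)) C) = fps_of_poly p \<and>
           degree p = r \<and> (\<forall>z. poly p z = 0 \<longrightarrow> z \<noteq> 0)))
     \<and>
     (has_unitary_rank c r \<longleftrightarrow>
        (\<exists>r'>0. \<exists>\<alpha> \<beta> lam :: nat \<Rightarrow> complex.
           (\<forall>j<r'. \<alpha> j \<noteq> 0 \<and> \<beta> j \<noteq> 0 \<and> lam j \<noteq> 0) \<and>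
           (\<forall>t\<ge>1.
              (\<Sum>j\<le>2 * r'. biv_const (of_nat (2 * r' choose j) * c (j + t))
                              * biv_x ^ (2 * r' - j) * biv_y ^ j) =
              (\<Sum>j<r'. biv_const (lam j * (\<beta> j / \<alpha> j) ^ t)
                          * (biv_const (\<alpha> j) * biv_x + biv_const (\<beta> j) * biv_y) ^ (2 * r'))) \<and>
           (\<forall>j<r'. \<alpha> j \<in> \<nat>) \<and> (\<Sum>j<r'. \<alpha> j) = of_nat r \<and>
           (\<forall>j<r'. lam j * \<alpha> j ^ (2 * r') = \<alpha> j)))
     \<and>
     (has_unitary_rank c r \<longleftrightarrow>
        (\<exists>(\<mu> :: complex set \<Rightarrow> complex) A.
           complex_measure borel \<mu> \<and> finite_atomic borel \<mu> A \<and> 0 \<notin> A \<and>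
           (\<forall>x\<in>A. \<mu> {x} \<in> \<nat> - {0}) \<and> (\<Sum>x\<in>A. \<mu> {x}) = of_nat r \<and>
           (\<forall>n\<ge>1. has_complex_measure_integral borel \<mu> (\<lambda>x. x ^ n) (c n))))"
  using has_unitary_rank_iff_MRANK[OF assms] has_unitary_rank_iff_simple_recurrence[OF assms]
    has_unitary_rank_iff_hankel[OF assms] has_unitary_rank_iff_hankel_inf[OF assms]
    has_unitary_rank_iff_exponential[OF assms] has_unitary_rank_iff_binomial_sums[OF assms]
    has_unitary_rank_iff_moments[OF assms]
  by (intro conjI)

end
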